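(* Let $Y$ be a smooth plane quartic curve over $K$ (of residue characteristic $3$) given by an affine equation $F(y)=0$ in normal form, let $\phi\colon Y\to X=\mathbb P^1_K$, $(x,y)\mapsto x$, be the associated degree-$3$ cover, let $x_0\in X$ be a closed point different from $\infty$, and let $z\in F_Y$ be the generator constructed in the context, with minimal polynomial $T^3+AT^2+BT+C$ over $K(t)$, $t=x-x_0$, where $$A=a_2t^2+a_1t+a_0,\quad B=b_3t^3+b_2t^2+b_1t+b_0,\quad C=c_4t^4+c_2t^2+c_1t .$$ Let $\xi\in[x_0,\infty]\subset X^{\mathrm{an}}$ be a Type II point that is a wild topological branch point of $\phi$. Then $$\delta(\xi)=\min\Big(\frac32,\ \frac{3v_\xi(A)}2-\frac{v_\xi(C)}2,\ \frac{3v_\xi(B)}2-v_\xi(C)\Big).$$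
   Context: Ground field. $K$ is an algebraically closed field of characteristic $0$, complete with respect to a non-archimedean rank-one valuation $v_K\colon K\to\mathbb R\cup\{\infty\}$ with perfect residue field $\kappa$ of characteristic $3$, normalized by $v_K(3)=1$; $K$ is the completion of an algebraic closure of a discretely valued field. Absolute values are $|\cdot|=e^{-v(\cdot)}$. Normal form: $F(y)=y^3+A_0y^2+B_0y+C_0$ with $A_0,B_0,C_0\in K[x]$ of degrees at most $2,3,4$; $F_Y=K(x,y)$ with $F(y)=0$. Construction of $z$. Choose a point $p_0\in Y$ above $x_0$ and put $y_0=y(p_0)$. The generator $y-y_0$ of $F_Y$ over $K(t)$ has minimal polynomial of the form $G(T)=T^3+(a_2t^2+a_1t+a_0)T^2+(b_3t^3+b_2t^2+b_1t+b_0)T+c_4t^4+c_3t^3+c_2t^2+c_1t$ with coefficients in $K$. Let $v\in K$ be a root of $v^3+a_1v^2+b_2v+c_3=0$, and put $z=y-y_0-vt$. Then the minimal polynomial $G(T+vt)$ of $z$ has the form stated in the claim (with new coefficients $a_i,b_i,c_i$): the constant coefficient has no terms of degree $0$ or $3$ in $t$. Analytification. $Y^{\mathrm{an}}$, $X^{\mathrm{an}}$ are Berkovich analytifications. Their points are the valuations $v_\eta$ on the function field extending $v_K$, together with the closed points (Type I). $\mathcal H(\eta)$ is the completed residue field, $\kappa(\eta)$ its residue field; $\eta$ is of Type II if $\kappa(\eta)/\kappa$ has transcendence degree $1$. $[x_0,\infty]$ is the unique path in $X^{\mathrm{an}}$ from $x_0$ to $\infty$; its Type II points are the Gauss valuations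 $\sum_id_it^i\mapsto\min_i(v_K(d_i)+ir)$, $r\in\mathbb Q$. A point $\xi\in X^{\mathrm{an}}$ is a wild topological branch point if it has a preimage $\eta$ with $3\mid[\mathcal H(\eta):\mathcal H(\xi)]$; then $\phi^{-1}(\xi)=\{\eta\}$. The function $\delta$. For $\eta\in Y^{\mathrm{an}}$ not of Type I with image $\xi=\phi(\eta)$, let $\delta^{\mathrm{CTT}}(\eta)\in(0,1]$ be the different of $\mathcal H(\eta)/\mathcal H(\xi)$ in the sense of Cohen–Temkin–Trushin, i.e. the supremum of $|a|$ over all $a\in\mathcal H(\eta)^\circ$ (valuation ring) annihilating $\Omega_{\mathcal H(\eta)^\circ/\mathcal H(\xi)^\circ}$. Put $\delta(\eta)=-\frac32\log\delta^{\mathrm{CTT}}(\eta)$ and $\delta(\xi):=\delta(\eta)$. ($v_\xi(0)=\infty$.) *)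

theory Defs
  imports
    Complex_Main
    "HOL-Library.Extended_Real"
    "HOL-Library.Poly_Mapping"
    "HOL-Computational_Algebra.Polynomial"
    "HOL-Computational_Algebra.Fraction_Field"
begin

section \<open>Fields and valuations\<close>

definition is_subfield :: "'a::field set \<Rightarrow> bool" where
  "is_subfield S \<longleftrightarrow> 0 \<in> S \<and> 1 \<in> S \<and>
     (\<forall>a\<in>S. \<forall>b\<in>S. a - b \<in> S \<and> a * b \<in> S) \<and> (\<forall>a\<in>S. inverse a \<in> S)"

definition field_emb :: "('a::field \<Rightarrow> 'b::field) \<Rightarrow> bool" where
  "field_emb f \<longleftrightarrow> f 0 = 0 \<and> f 1 = 1 \<and>
     (\<forall>a b. f (a + b) = f a + f b) \<and> (\<forall>a b. f (a * b) = f a * f b)"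

text \<open>The degree of a field extension given by an embedding. As for \<^const>\<open>vector_space.dim\<close>,
  the value is \<open>0\<close> if the extension is infinite.\<close>

definition ext_degree :: "('a::field \<Rightarrow> 'b::field) \<Rightarrow> nat" where
  "ext_degree i = vector_space.dim (\<lambda>c x. i c * x) UNIV"

definition is_min_poly :: "('a::field \<Rightarrow> 'b::field) \<Rightarrow> 'b \<Rightarrow> 'a poly \<Rightarrow> bool" where
  "is_min_poly i z p \<longleftrightarrow> lead_coeff p = 1 \<and> poly (map_poly i p) z = 0 \<and>
     (\<forall>q. q \<noteq> 0 \<and> poly (map_poly i q) z = 0 \<longrightarrow> degree p \<le> degree q)"

text \<open>Additive valuations of rank at most one.\<close>

definition is_valuation :: "('a::field \<Rightarrow> ereal) \<Rightarrow> bool" where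
  "is_valuation v \<longleftrightarrow> (\<forall>a. v a \<noteq> -\<infinity>) \<and> (\<forall>a. v a = \<infinity> \<longleftrightarrow> a = 0) \<and>
     (\<forall>a b. v (a * b) = v a + v b) \<and> (\<forall>a b. min (v a) (v b) \<le> v (a + b))"

definition val_ring :: "('a::field \<Rightarrow> ereal) \<Rightarrow> 'a set" where
  "val_ring v = {a. 0 \<le> v a}"

definition val_abs :: "('a::field \<Rightarrow> ereal) \<Rightarrow> 'a \<Rightarrow> real" where
  "val_abs v a = (if a = 0 then 0 else exp (- real_of_ereal (v a)))"

definition val_Cauchy :: "('a::field \<Rightarrow> ereal) \<Rightarrow> (nat \<Rightarrow> 'a) \<Rightarrow> bool" where
  "val_Cauchy v s \<longleftrightarrow> (\<forall>M::real. \<exists>N. \<forall>m\<ge>N. \<forall>n\<ge>N. ereal M \<le> v (s m - s n))"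

definition val_tendsto :: "('a::field \<Rightarrow> ereal) \<Rightarrow> (nat \<Rightarrow> 'a) \<Rightarrow> 'a \<Rightarrow> bool" where
  "val_tendsto v s l \<longleftrightarrow> (\<forall>M::real. \<exists>N. \<forall>n\<ge>N. ereal M \<le> v (s n - l))"

definition val_complete :: "('a::field \<Rightarrow> ereal) \<Rightarrow> bool" where
  "val_complete v \<longleftrightarrow> (\<forall>s. val_Cauchy v s \<longrightarrow> (\<exists>l. val_tendsto v s l))"

definition val_dense :: "('a::field \<Rightarrow> ereal) \<Rightarrow> 'a set \<Rightarrow> bool" where
  "val_dense v S \<longleftrightarrow> (\<forall>a. \<forall>M::real. \<exists>s\<in>S. ereal M \<le> v (a - s))"

text \<open>\<open>(w, j)\<close> is a completion of the valued field \<open>v\<close>; this determines \<open>w\<close> and \<open>j\<close> up to a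
  unique isomorphism.\<close>

definition is_completion ::
    "('a::field \<Rightarrow> ereal) \<Rightarrow> ('b::field \<Rightarrow> ereal) \<Rightarrow> ('a \<Rightarrow> 'b) \<Rightarrow> bool" where
  "is_completion v w j \<longleftrightarrow> is_valuation w \<and> val_complete w \<and> field_emb j \<and>
     (\<forall>a. w (j a) = v a) \<and> val_dense w (range j)"

definition discrete_on :: "('a::field \<Rightarrow> ereal) \<Rightarrow> 'a set \<Rightarrow> bool" where
  "discrete_on v S \<longleftrightarrow> (\<exists>c>0. v ` (S - {0}) = range (\<lambda>n::int. ereal (of_int n * c)))"

text \<open>For a subfield \<open>S\<close> of an algebraically closed field this is the algebraic closure of \<open>S\<close>.\<close>

definition algebraic_over :: "'a::field set \<Rightarrow> 'a set" where
  "algebraic_over S = {a. \<exists>p. p \<noteq> 0 \<and> range (coeff p) \<subseteq> S \<and> poly p a = 0}"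

text \<open>The residue field has characteristic \<open>3\<close> because the valuation of \<open>3\<close> is positive. It is
  perfect if its Frobenius map is surjective, which is the third condition.\<close>

definition ground_field :: "('k::{alg_closed_field,field_char_0} \<Rightarrow> ereal) \<Rightarrow> bool" where
  "ground_field v \<longleftrightarrow> is_valuation v \<and> val_complete v \<and>
     (\<forall>a\<in>val_ring v. \<exists>b\<in>val_ring v. 0 < v (a - b ^ 3)) \<and>
     v 3 = 1 \<and>
     (\<exists>K0. is_subfield K0 \<and> discrete_on v K0 \<and> val_dense v (algebraic_over K0))"

section \<open>The quartic and its function field\<close>

text \<open>The degree \<open>n\<close> homogenization of \<open>p\<close>, evaluated at polynomials \<open>X\<close>, \<open>Z\<close>.\<close>

definition homog :: "nat \<Rightarrow> 'k::field poly \<Rightarrow> 'k poly \<Rightarrow> 'k poly \<Rightarrow> 'k poly" where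
  "homog n p X Z = (\<Sum>i\<le>n. smult (coeff p i) (X ^ i * Z ^ (n - i)))"

definition quartic_form ::
    "'k::field poly \<Rightarrow> 'k poly \<Rightarrow> 'k poly \<Rightarrow> 'k poly \<Rightarrow> 'k poly \<Rightarrow> 'k poly \<Rightarrow> 'k poly" where
  "quartic_form A B C X Y Z =
     Y ^ 3 * Z + homog 2 A X Z * Y ^ 2 + homog 3 B X Z * Y + homog 4 C X Z"

text \<open>The projective Jacobian criterion. The partial derivative of the form with respect to a
  coordinate is obtained by specializing the other two coordinates to constants.\<close>

definition smooth_plane_quartic :: "'k::field poly \<Rightarrow> 'k poly \<Rightarrow> 'k poly \<Rightarrow> bool" where
  "smooth_plane_quartic A B C \<longleftrightarrow>
     (\<forall>a b c. (a, b, c) \<noteq> (0, 0, 0) \<and> quartic_form A B C [:a:] [:b:] [:c:] = 0 \<longrightarrow>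
        poly (pderiv (quartic_form A B C [:0, 1:] [:b:] [:c:])) a \<noteq> 0 \<or>
        poly (pderiv (quartic_form A B C [:a:] [:0, 1:] [:c:])) b \<noteq> 0 \<or>
        poly (pderiv (quartic_form A B C [:a:] [:b:] [:0, 1:])) c \<noteq> 0)"

text \<open>\<open>K(x)\<close> is the fraction field of \<open>K[x]\<close>. A polynomial \<open>d\<close> gives the element \<open>d(x)\<close>, and it
  gives \<open>d(t)\<close> for \<open>t = x - x0\<close>.\<close>

definition in_x :: "'k::field poly \<Rightarrow> 'k poly fract" where
  "in_x d = Fract d 1"

definition in_t :: "'k::field \<Rightarrow> 'k poly \<Rightarrow> 'k poly fract" where
  "in_t x0 d = in_x (pcompose d [:- x0, 1:])"

text \<open>\<open>K(x, y)\<close> with \<open>y^3 + A y^2 + B y + C = 0\<close>, as an extension of \<open>K(x)\<close>.\<close>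

definition is_function_field ::
    "'k::field poly \<Rightarrow> 'k poly \<Rightarrow> 'k poly \<Rightarrow> ('k poly fract \<Rightarrow> 'f::field) \<Rightarrow> 'f \<Rightarrow> bool" where
  "is_function_field A B C emb y \<longleftrightarrow> field_emb emb \<and>
     y ^ 3 + emb (in_x A) * y ^ 2 + emb (in_x B) * y + emb (in_x C) = 0 \<and>
     (\<forall>S. is_subfield S \<and> range emb \<subseteq> S \<and> y \<in> S \<longrightarrow> S = UNIV)"

section \<open>Points of the analytifications\<close>

text \<open>The Type II points of the path from \<open>x0\<close> to infinity.\<close>

definition type_II_on_path ::
    "('k::field \<Rightarrow> ereal) \<Rightarrow> 'k \<Rightarrow> ('k poly fract \<Rightarrow> ereal) \<Rightarrow> bool" where
  "type_II_on_path vK x0 \<xi> \<longleftrightarrow> is_valuation \<xi> \<and>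
     (\<exists>r\<in>\<rat>. \<forall>d. \<xi> (in_t x0 d) = (MIN i\<in>{..degree d}. vK (coeff d i) + ereal (real i * r)))"

text \<open>A point of \<open>Y\<close> (not of Type I) over the point \<open>\<xi>\<close> of \<open>X\<close>. It extends the valuation of
  the ground field if \<open>\<xi>\<close> does.\<close>

definition lies_over ::
    "('b::field \<Rightarrow> 'f::field) \<Rightarrow> ('f \<Rightarrow> ereal) \<Rightarrow> ('b \<Rightarrow> ereal) \<Rightarrow> bool" where
  "lies_over emb \<eta> \<xi> \<longleftrightarrow> is_valuation \<eta> \<and> (\<forall>f. \<eta> (emb f) = \<xi> f)"

text \<open>\<open>i\<close> is the extension of completed residue fields induced by \<open>emb\<close>, where \<open>(w\<xi>, j\<xi>)\<close> and
  \<open>(w\<eta>, j\<eta>)\<close> are the completed residue fields of \<open>\<xi>\<close> and \<open>\<eta>\<close>.\<close>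

definition is_induced ::
    "('b::field \<Rightarrow> 'f::field) \<Rightarrow> ('g::field \<Rightarrow> ereal) \<Rightarrow> ('b \<Rightarrow> 'g) \<Rightarrow>
     ('h::field \<Rightarrow> ereal) \<Rightarrow> ('f \<Rightarrow> 'h) \<Rightarrow> ('g \<Rightarrow> 'h) \<Rightarrow> bool" where
  "is_induced emb w\<xi> j\<xi> w\<eta> j\<eta> i \<longleftrightarrow> field_emb i \<and>
     (\<forall>a. w\<eta> (i a) = w\<xi> a) \<and> (\<forall>f. i (j\<xi> f) = j\<eta> (emb f))"

section \<open>The different\<close>

text \<open>For a subring \<open>B\<close> of the ambient ring, the free \<open>B\<close>-module on symbols \<open>d x\<close> with \<open>x\<close> in \<open>B\<close>;
  \<open>Poly_Mapping.single x b\<close> stands for \<open>b d x\<close>.\<close>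

definition kaehler_free :: "'b::comm_ring_1 set \<Rightarrow> ('b \<Rightarrow>\<^sub>0 'b) set" where
  "kaehler_free B = {\<omega>. Poly_Mapping.keys \<omega> \<subseteq> B \<and> range (Poly_Mapping.lookup \<omega>) \<subseteq> B}"

text \<open>The submodule of relations whose quotient is the module of Kaehler differentials of \<open>B\<close>
  over \<open>A\<close>.\<close>

inductive_set kaehler_rel :: "'b::comm_ring_1 set \<Rightarrow> 'b set \<Rightarrow> ('b \<Rightarrow>\<^sub>0 'b) set"
  for A B :: "'b set" where
  zero: "0 \<in> kaehler_rel A B"
| plus: "p \<in> kaehler_rel A B \<Longrightarrow> q \<in> kaehler_rel A B \<Longrightarrow> p + q \<in> kaehler_rel A B"
| scale: "b \<in> B \<Longrightarrow> p \<in> kaehler_rel A B \<Longrightarrow> Poly_Mapping.map ((*) b) p \<in> kaehler_rel A B"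
| d_add: "x \<in> B \<Longrightarrow> y \<in> B \<Longrightarrow>
    Poly_Mapping.single (x + y) 1 - Poly_Mapping.single x 1 - Poly_Mapping.single y 1
      \<in> kaehler_rel A B"
| d_mult: "x \<in> B \<Longrightarrow> y \<in> B \<Longrightarrow>
    Poly_Mapping.single (x * y) 1 - Poly_Mapping.single y x - Poly_Mapping.single x y
      \<in> kaehler_rel A B"
| d_base: "x \<in> A \<Longrightarrow> Poly_Mapping.single x 1 \<in> kaehler_rel A B"

definition annihilates_kaehler :: "'b::comm_ring_1 set \<Rightarrow> 'b set \<Rightarrow> 'b \<Rightarrow> bool" where
  "annihilates_kaehler A B a \<longleftrightarrow>
     (\<forall>\<omega>\<in>kaehler_free B. Poly_Mapping.map ((*) a) \<omega> \<in> kaehler_rel A B)"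

definition delta_CTT ::
    "('g::field \<Rightarrow> ereal) \<Rightarrow> ('h::field \<Rightarrow> ereal) \<Rightarrow> ('g \<Rightarrow> 'h) \<Rightarrow> real" where
  "delta_CTT wg wh i =
     (SUP a\<in>{a \<in> val_ring wh. annihilates_kaehler (i ` val_ring wg) (val_ring wh) a}. val_abs wh a)"

definition delta ::
    "('g::field \<Rightarrow> ereal) \<Rightarrow> ('h::field \<Rightarrow> ereal) \<Rightarrow> ('g \<Rightarrow> 'h) \<Rightarrow> real" where
  "delta wg wh i = - (3 / 2) * ln (delta_CTT wg wh i)"

end

theory Submission
  imports Defs
begin

text \<open>
  Choose \<open>\<kappa> \<in> K\<close> with \<open>v(\<kappa>\<^sup>3) = v\<^sub>\<xi>(C)\<close>, which exists because the value group of \<open>K\<close> is divisible and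
  contains the rational numbers, and replace \<open>z\<close> by \<open>\<zeta> = z / \<kappa>\<close>. Its cubic \<open>T\<^sup>3 + a T\<^sup>2 + b T + c\<close> has
  \<open>v(c) = 0\<close>, and the claim becomes \<open>v(\<DD>) = min (v(3), v(a), v(b))\<close> for the different \<open>\<DD>\<close> of the
  extension \<open>\<H>(\<eta>) / \<H>(\<xi>)\<close>. The right hand side is the valuation of \<open>F'(\<zeta>) = 3 \<zeta>\<^sup>2 + 2 a \<zeta> + b\<close> as
  soon as \<open>1, \<zeta>, \<zeta>\<^sup>2\<close> is an orthogonal basis of the extension. In that case the valuation ring of
  \<open>\<H>(\<eta>)\<close> is generated by \<open>\<zeta>\<close>, so its module of differentials is cyclic with annihilator
  \<open>(F'(\<zeta>))\<close>, and the formula follows (\<open>delta_eq\<close>).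

  Orthogonality holds if the cubic is integral and has no root in the residue field
  (\<open>basis_orthogonal\<close>). The span of \<open>1, \<zeta>, \<zeta>\<^sup>2\<close> over the complete field \<open>\<H>(\<xi>)\<close> is closed and
  contains the function field of \<open>Y\<close>, hence is all of \<open>\<H>(\<eta>)\<close>. The degree of the extension is a
  multiple of \<open>3\<close>, so the cubic has no root in \<open>\<H>(\<xi>)\<close> (\<open>no_root_in_base\<close>). By Hensel's lemma its
  Newton polygon then has a single slope, which gives integrality (\<open>rootless_cubic_integral\<close>), and
  it can only have a root modulo the maximal ideal if it is congruent to the cube of a linear
  polynomial, in which case \<open>- c\<close> is congruent to a cube (\<open>rootless_cubic_residue_root\<close>).

  This is where the choice of \<open>z\<close> enters: \<open>C\<close> only has terms of degree \<open>1\<close>, \<open>2\<close> and \<open>4\<close> in \<open>t\<close>. The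
  operator \<open>t d/dt\<close> does not decrease Gauss valuations, multiplies the terms of \<open>C\<close> by the units
  \<open>1, 2, 4\<close>, and makes cubes smaller by the factor \<open>3\<close>. Hence \<open>- C\<close> is not congruent to a cube
  (\<open>not_near_cube\<close>).
\<close>

section \<open>Arithmetic of valuations\<close>

locale valuation =
  fixes v :: "'a::field \<Rightarrow> ereal"
  assumes is_val: "is_valuation v"
begin

lemma
  shows not_minf [simp]: "v x \<noteq> -\<infinity>"
    and eq_inf_iff [simp]: "v x = \<infinity> \<longleftrightarrow> x = 0"
    and mult: "v (x * y) = v x + v y"
    and add_min: "min (v x) (v y) \<le> v (x + y)"
  using is_val unfolding is_valuation_def by blast+

lemma zero [simp]: "v 0 = \<infinity>"
  by simp

lemma finite_val:
  assumes "x \<noteq> 0"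
  obtains r where "v x = ereal r"
  using assms not_minf[of x] eq_inf_iff[of x] by (cases "v x") auto

lemma one [simp]: "v 1 = 0"
proof -
  obtain r where r: "v 1 = ereal r"
    using finite_val[of 1] by auto
  have "ereal r = ereal r + ereal r"
    using mult[of 1 1] r by simp
  then show ?thesis
    using r by (simp add: zero_ereal_def)
qed

lemma minus [simp]: "v (- x) = v x"
proof -
  obtain r where r: "v (- 1) = ereal r"
    using finite_val[of "- 1"] by auto
  have "ereal r + ereal r = 0"
    using mult[of "- 1" "- 1"] r by simp
  then have "v (- 1) = 0"
    using r by (simp add: zero_ereal_def)
  then show ?thesis
    using mult[of "- 1" x] by simp
qed

lemma diff_commute: "v (x - y) = v (y - x)"
  using minus[of "x - y"] by simp

lemma add_ge: "m \<le> v x \<Longrightarrow> m \<le> v y \<Longrightarrow> m \<le> v (x + y)"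
  using add_min[of x y] by (metis min.bounded_iff order_trans)

lemma add_gt: "m < v x \<Longrightarrow> m < v y \<Longrightarrow> m < v (x + y)"
  using add_min[of x y] by (metis min_less_iff_conj order_less_le_trans)

lemma diff_ge: "m \<le> v x \<Longrightarrow> m \<le> v y \<Longrightarrow> m \<le> v (x - y)"
  using add_ge[of m x "- y"] by simp

lemma diff_gt: "m < v x \<Longrightarrow> m < v y \<Longrightarrow> m < v (x - y)"
  using add_gt[of m x "- y"] by simp

lemma add_eq:
  assumes "v x < v y"
  shows "v (x + y) = v x"
proof (rule antisym)
  show "v x \<le> v (x + y)"
    using add_ge[of "v x" x y] assms by simp
  show "v (x + y) \<le> v x"
  proof (rule ccontr)
    assume "\<not> ?thesis"
    then have "v x < v (x + y - y)"
      using assms by (intro diff_gt) auto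
    then show False
      by simp
  qed
qed

lemma diff_eq: "v x < v y \<Longrightarrow> v (x - y) = v x"
  using add_eq[of x "- y"] by simp

lemma mult_ge: "ereal m \<le> v x \<Longrightarrow> ereal n \<le> v y \<Longrightarrow> ereal (m + n) \<le> v (x * y)"
  using add_mono[of "ereal m" "v x" "ereal n" "v y"] by (simp add: mult)

lemma mult_nonneg: "0 \<le> v x \<Longrightarrow> 0 \<le> v y \<Longrightarrow> 0 \<le> v (x * y)"
  by (simp add: mult)

lemma mult_pos: "0 < v x \<Longrightarrow> 0 \<le> v y \<Longrightarrow> 0 < v (x * y)"
  by (simp add: mult add_pos_nonneg)

lemma mult_pos': "0 \<le> v x \<Longrightarrow> 0 < v y \<Longrightarrow> 0 < v (x * y)"
  by (simp add: mult add_nonneg_pos)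

lemma power_nonneg: "0 \<le> v x \<Longrightarrow> 0 \<le> v (x ^ n)"
  by (induction n) (auto intro: mult_nonneg)

lemma power_ereal: "v x = ereal r \<Longrightarrow> v (x ^ n) = ereal (real n * r)"
  by (induction n) (auto simp: mult algebra_simps zero_ereal_def)

lemma cube: "v (x ^ 3) = v x + v x + v x"
  by (simp add: power3_eq_cube mult)

lemma square: "v (x ^ 2) = v x + v x"
  by (simp add: power2_eq_square mult)

lemma inverse_ereal: "x \<noteq> 0 \<Longrightarrow> v x = ereal r \<Longrightarrow> v (inverse x) = ereal (- r)"
proof -
  assume "x \<noteq> 0" and r: "v x = ereal r"
  then obtain s where s: "v (inverse x) = ereal s"
    using finite_val[of "inverse x"] by auto
  have "v (x * inverse x) = 0"
    using \<open>x \<noteq> 0\<close> by simp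
  then show ?thesis
    by (simp add: mult r s zero_ereal_def)
qed

lemma divide_ereal: "y \<noteq> 0 \<Longrightarrow> v x = ereal r \<Longrightarrow> v y = ereal s \<Longrightarrow> v (x / y) = ereal (r - s)"
  by (simp add: divide_inverse mult inverse_ereal)

lemma divide_unit: "v y = 0 \<Longrightarrow> v (x / y) = v x"
proof -
  assume y: "v y = 0"
  then have "y \<noteq> 0"
    by auto
  then have "v x = v (x / y) + v y"
    using mult[of "x / y" y] by simp
  then show ?thesis
    using y by simp
qed

lemma of_nat_nonneg: "0 \<le> v (of_nat n)"
  by (induction n) (auto intro: add_ge)

lemma numeral_nonneg: "0 \<le> v (numeral n)"
  using of_nat_nonneg[of "numeral n"] by simp

lemma two_unit:
  assumes "0 < v 3"
  shows "v 2 = 0"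
  using diff_eq[of "- 1" "- 3"] assms by simp

lemmas ring_nonneg = add_ge diff_ge mult_nonneg power_nonneg numeral_nonneg

lemma tendsto_Cauchy:
  assumes "val_tendsto v s l"
  shows "val_Cauchy v s"
  unfolding val_Cauchy_def
proof
  fix M :: real
  obtain N where N: "\<And>n. n \<ge> N \<Longrightarrow> ereal M \<le> v (s n - l)"
    using assms unfolding val_tendsto_def by blast
  have "ereal M \<le> v (s m - s n)" if "m \<ge> N" "n \<ge> N" for m n
    using diff_ge[OF N[OF that(1)] N[OF that(2)]] by simp
  then show "\<exists>N. \<forall>m\<ge>N. \<forall>n\<ge>N. ereal M \<le> v (s m - s n)"
    by blast
qed

lemma eq_zeroI: "(\<And>M::real. ereal M \<le> v x) \<Longrightarrow> x = 0"
  using ereal_top[of "v x"] by simp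

lemma tendsto_const_close:
  assumes "\<And>n::nat. ereal (real n) \<le> v (l - s n)"
  shows "val_tendsto v s l"
  unfolding val_tendsto_def
proof
  fix M :: real
  obtain N where "M \<le> real N"
    using real_arch_simple by blast
  then have "ereal M \<le> v (s n - l)" if "n \<ge> N" for n
    using assms[of n] that diff_commute[of l "s n"]
    by (metis ereal_less_eq(3) of_nat_mono order_trans)
  then show "\<exists>N. \<forall>n\<ge>N. ereal M \<le> v (s n - l)"
    by blast
qed

text \<open>By the ultrametric inequality, a sequence is Cauchy as soon as consecutive terms get
  close to each other at a linear rate.\<close>

lemma Cauchy_linear:
  assumes "0 < \<epsilon>" and step: "\<And>n::nat. ereal (real n * \<epsilon>) \<le> v (s (Suc n) - s n)"
  shows "val_Cauchy v s"
  unfolding val_Cauchy_def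
proof
  fix M :: real
  obtain N where N: "M / \<epsilon> \<le> real N"
    using real_arch_simple by blast
  have close: "ereal M \<le> v (s (N + k) - s N)" for k
  proof (induction k)
    case (Suc k)
    have "M \<le> real (N + k) * \<epsilon>"
      using N \<open>0 < \<epsilon>\<close> by (simp add: field_simps add_increasing2)
    then have "ereal M \<le> v (s (Suc (N + k)) - s (N + k))"
      using step[of "N + k"] by (meson ereal_less_eq(3) order_trans)
    from add_ge[OF this Suc] show ?case
      by simp
  qed simp
  have "ereal M \<le> v (s m - s n)" if "m \<ge> N" "n \<ge> N" for m n
    using diff_ge[OF close[of "m - N"] close[of "n - N"]] that by simp
  then show "\<exists>N. \<forall>m\<ge>N. \<forall>n\<ge>N. ereal M \<le> v (s m - s n)"
    by blast
qed

end

section \<open>Cubics over a complete field\<close>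

locale complete_valuation = valuation +
  assumes complete: "val_complete v"
begin

text \<open>Hensel's lemma for a simple root at \<open>0\<close>. The root is the fixed point of
  \<open>x \<mapsto> - (p x\<^sup>3 + a x\<^sup>2 + c) / b\<close>, which contracts a ball around \<open>0\<close>.\<close>

lemma Hensel_cubic:
  assumes p: "0 \<le> v p" and a: "0 \<le> v a" and b: "v b = 0" and c: "0 < v c"
  shows "\<exists>x. p * x ^ 3 + a * x ^ 2 + b * x + c = 0"
proof -
  have b0: "b \<noteq> 0"
    using b by auto
  obtain \<epsilon> where \<epsilon>: "0 < \<epsilon>" "ereal \<epsilon> \<le> v c"
    using c by (metis ereal_dense2 ereal_less(2) less_imp_le)
  define g where "g x = - (p * x ^ 3 + a * x ^ 2 + c) / b" for x
  have sq: "ereal \<epsilon> \<le> v (x * y)" if "ereal \<epsilon> \<le> v x" "0 \<le> v y" for x y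
    using mult_ge[of \<epsilon> x 0 y] that by (simp add: zero_ereal_def)
  have nn: "0 \<le> v x" if "ereal \<epsilon> \<le> v x" for x
    using that \<epsilon>(1) by (meson ereal_less_eq(3) less_imp_le order_trans ereal_less_eq(5))
  have g_ball: "ereal \<epsilon> \<le> v (g x)" if x: "ereal \<epsilon> \<le> v x" for x
  proof -
    have "p * x ^ 3 + a * x ^ 2 + c = x * (p * x ^ 2 + a * x) + c"
      by (simp add: algebra_simps power3_eq_cube power2_eq_square)
    also have "ereal \<epsilon> \<le> v \<dots>"
      using \<epsilon>(2) x nn[OF x] p a by (intro add_ge sq ring_nonneg) auto
    finally show ?thesis
      unfolding g_def using b minus by (simp add: divide_unit del: minus_add_distrib)
  qed
  have g_contract: "ereal (m + \<epsilon>) \<le> v (g x - g y)"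
    if x: "ereal \<epsilon> \<le> v x" and y: "ereal \<epsilon> \<le> v y" and m: "ereal m \<le> v (x - y)" for x y m
  proof -
    have "p * (x * x + x * y + y * y) + a * (x + y) =
        x * (p * x) + x * (p * y) + y * (p * y) + x * a + y * a"
      by (simp add: algebra_simps)
    also have "ereal \<epsilon> \<le> v \<dots>"
      using x y nn[OF x] nn[OF y] p a by (intro add_ge sq ring_nonneg) auto
    finally have "ereal (m + \<epsilon>) \<le> v ((x - y) * (p * (x * x + x * y + y * y) + a * (x + y)))"
      by (intro mult_ge m)
    also have "\<dots> = v (- ((x - y) * (p * (x * x + x * y + y * y) + a * (x + y))) / b)"
      using b by (simp add: divide_unit)
    also have "- ((x - y) * (p * (x * x + x * y + y * y) + a * (x + y))) / b = g x - g y"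
      unfolding g_def using b0 by (simp add: field_simps power3_eq_cube power2_eq_square)
    finally show ?thesis .
  qed
  define s where "s n = (g ^^ n) 0" for n
  have s_ball: "ereal \<epsilon> \<le> v (s n)" for n
    unfolding s_def by (induction n) (auto intro: g_ball)
  have s_step: "ereal (real n * \<epsilon>) \<le> v (s (Suc n) - s n)" for n
  proof (induction n)
    case 0
    then show ?case
      using diff_ge[OF nn[OF s_ball[of 1]] nn[OF s_ball[of 0]]]
      by (simp add: zero_ereal_def[symmetric])
  next
    case (Suc n)
    then have "ereal (real n * \<epsilon> + \<epsilon>) \<le> v (g (s (Suc n)) - g (s n))"
      by (intro g_contract s_ball)
    then show ?case
      by (simp add: s_def algebra_simps)
  qed
  obtain l where l: "val_tendsto v s l"
    using complete Cauchy_linear[OF \<epsilon>(1) s_step] unfolding val_complete_def by blast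
  have l_ball: "ereal \<epsilon> \<le> v l"
  proof -
    obtain n where "ereal \<epsilon> \<le> v (s n - l)"
      using l unfolding val_tendsto_def by blast
    from diff_ge[OF s_ball[of n] this] show ?thesis
      by simp
  qed
  have "g l - l = 0"
  proof (rule eq_zeroI)
    fix M :: real
    obtain N where N: "\<And>n. n \<ge> N \<Longrightarrow> ereal M \<le> v (s n - l)"
      using l unfolding val_tendsto_def by blast
    have "ereal (M + \<epsilon>) \<le> v (g (s N) - g l)"
      using N by (intro g_contract s_ball l_ball) auto
    then have "ereal M \<le> v (g (s N) - g l)"
      using \<epsilon>(1) by (meson ereal_less_eq(3) order_trans less_add_same_cancel1 less_imp_le)
    from diff_ge[OF N[of "Suc N"] this] show "ereal M \<le> v (g l - l)"
      by (simp add: s_def)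
  qed
  then have "b * g l = b * l"
    by simp
  moreover have "b * g l = - (p * l ^ 3 + a * l ^ 2 + c)"
    unfolding g_def using b0 by simp
  ultimately have "p * l ^ 3 + a * l ^ 2 + b * l + c = 0"
    by algebra
  then show ?thesis
    by blast
qed

text \<open>If a coefficient had negative valuation, the Newton polygon would have a vertex over \<open>2\<close>, or
  over \<open>1\<close> only. In the first case there is a root of the size of \<open>a\<close>, in the second case one of
  the size of \<open>c / b\<close>: after rescaling, both are simple roots modulo the maximal ideal.\<close>

lemma rootless_cubic_integral:
  assumes c: "v c = 0" and no_root: "\<And>x. x ^ 3 + a * x ^ 2 + b * x + c \<noteq> 0"
  shows "0 \<le> v a \<and> 0 \<le> v b"
proof (rule ccontr)
  assume neg: "\<not> ?thesis"
  have c0: "c \<noteq> 0"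
    using c by auto
  show False
  proof (cases "v b \<le> v a + v a")
    case True
    then have "v b < 0"
      using neg add_neg_neg[of "v a" "v a"] by force
    then have b0: "b \<noteq> 0"
      by auto
    then obtain \<beta> where \<beta>: "v b = ereal \<beta>"
      using finite_val by blast
    then have "\<beta> < 0"
      using \<open>v b < 0\<close> by simp
    have c': "v (c ^ n) = ereal 0" for n
      using power_ereal[of c 0 n] c by simp
    \<comment> \<open>Substituting \<open>(c / b) S\<close> gives \<open>p S\<^sup>3 + q S\<^sup>2 + S + 1\<close> up to the factor \<open>c\<close>, with the simple
      root \<open>- 1\<close> modulo the maximal ideal. The shift \<open>S = u - 1\<close> moves it to \<open>0\<close>.\<close>
    define p where "p = c ^ 2 / b ^ 3"
    define q where "q = a * c / b ^ 2"
    have "v p = ereal (0 - real 3 * \<beta>)"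
      unfolding p_def using b0 by (intro divide_ereal power_ereal \<beta> c') auto
    then have p0: "0 < v p"
      using \<open>\<beta> < 0\<close> by simp
    have q0: "0 < v q"
    proof (cases "a = 0")
      case False
      then obtain \<alpha> where \<alpha>: "v a = ereal \<alpha>"
        using finite_val by blast
      have "v q = ereal (\<alpha> - real 2 * \<beta>)"
        unfolding q_def using b0 by (intro divide_ereal power_ereal \<beta>) (auto simp: mult \<alpha> c)
      moreover have "\<beta> \<le> 2 * \<alpha>"
        using True \<alpha> \<beta> by simp
      ultimately show ?thesis
        using \<open>\<beta> < 0\<close> by simp
    qed (auto simp: q_def)
    have lin: "v (1 + (3 * p - 2 * q)) = 0"
      using add_eq[of 1 "3 * p - 2 * q"] p0 q0
      by (simp add: diff_gt mult_pos' numeral_nonneg)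
    have "\<exists>u. p * u ^ 3 + (q - 3 * p) * u ^ 2 + (1 + (3 * p - 2 * q)) * u + (q - p) = 0"
      using p0 q0 by (intro Hensel_cubic lin ring_nonneg diff_gt) auto
    then obtain u where u: "p * u ^ 3 + (q - 3 * p) * u ^ 2 + (1 + (3 * p - 2 * q)) * u + (q - p) = 0"
      by blast
    define S where "S = u - 1"
    have S: "p * S ^ 3 + q * S ^ 2 + S + 1 = 0"
      using u unfolding S_def by algebra
    define h where "h = c / b"
    have "h ^ 3 = c * p" "a * h ^ 2 = c * q" "b * h = c"
      unfolding h_def p_def q_def using b0
      by (simp_all add: power_divide power2_eq_square power3_eq_cube)
    then have "(h * S) ^ 3 + a * (h * S) ^ 2 + b * (h * S) + c = c * (p * S ^ 3 + q * S ^ 2 + S + 1)"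
      by (simp add: power_mult_distrib algebra_simps)
    then show False
      using no_root[of "h * S"] S by (simp only: mult_zero_right)
  next
    case False
    then have a_b: "v a + v a < v b"
      by simp
    have "v a < 0"
    proof (rule ccontr)
      assume "\<not> ?thesis"
      then have a_nn: "0 \<le> v a"
        by simp
      from add_nonneg_nonneg[OF this this] a_b have "0 \<le> v b"
        by order
      then show False
        using neg a_nn by simp
    qed
    then have a0: "a \<noteq> 0"
      by auto
    then obtain \<alpha> where \<alpha>: "v a = ereal \<alpha>"
      using finite_val by blast
    then have "\<alpha> < 0"
      using \<open>v a < 0\<close> by simp
    \<comment> \<open>Substituting \<open>a S\<close> gives \<open>S\<^sup>3 + S\<^sup>2 + p S + q\<close> up to the factor \<open>a\<^sup>3\<close>, again with the simple
      root \<open>- 1\<close> modulo the maximal ideal.\<close>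
    define p where "p = b / a ^ 2"
    define q where "q = c / a ^ 3"
    have p0: "0 < v p"
    proof (cases "b = 0")
      case False
      then obtain \<beta> where \<beta>: "v b = ereal \<beta>"
        using finite_val by blast
      have "v p = ereal (\<beta> - real 2 * \<alpha>)"
        unfolding p_def using a0 by (intro divide_ereal power_ereal \<beta> \<alpha>) auto
      then show ?thesis
        using a_b \<alpha> \<beta> by simp
    qed (auto simp: p_def)
    have "v q = ereal (0 - real 3 * \<alpha>)"
      unfolding q_def using a0 c by (intro divide_ereal power_ereal \<alpha>) auto
    then have q0: "0 < v q"
      using \<open>\<alpha> < 0\<close> by simp
    have lin: "v (1 + p) = 0"
      using add_eq[of 1 p] p0 by simp
    have "\<exists>u. 1 * u ^ 3 + (- 2) * u ^ 2 + (1 + p) * u + (q - p) = 0"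
      using p0 q0 by (intro Hensel_cubic lin diff_gt) (auto simp: numeral_nonneg)
    then obtain u where u: "1 * u ^ 3 + (- 2) * u ^ 2 + (1 + p) * u + (q - p) = 0"
      by blast
    define S where "S = u - 1"
    have S: "S ^ 3 + S ^ 2 + p * S + q = 0"
      using u unfolding S_def by algebra
    have "b = a ^ 2 * p" "c = a ^ 3 * q"
      unfolding p_def q_def using a0 by simp_all
    then have "(a * S) ^ 3 + a * (a * S) ^ 2 + b * (a * S) + c = a ^ 3 * (S ^ 3 + S ^ 2 + p * S + q)"
      by (simp add: power_mult_distrib algebra_simps power2_eq_square power3_eq_cube)
    then show False
      using no_root[of "a * S"] S by (simp only: mult_zero_right)
  qed
qed

text \<open>In residue characteristic \<open>3\<close>, a cubic without roots can only have a root modulo the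
  maximal ideal if it is a cube there: in its expansion around \<open>s\<close>, a unit linear coefficient
  makes \<open>s\<close> a simple root, and otherwise a unit quadratic coefficient \<open>\<alpha>\<close> makes \<open>s - \<alpha>\<close> one.\<close>

lemma rootless_cubic_residue_root:
  assumes three: "0 < v 3" and a: "0 \<le> v a" and b: "0 \<le> v b"
    and no_root: "\<And>x. x ^ 3 + a * x ^ 2 + b * x + c \<noteq> 0"
    and s: "0 \<le> v s" and root: "0 < v (s ^ 3 + a * s ^ 2 + b * s + c)"
  shows "0 < v (c + s ^ 3)"
proof -
  define \<alpha> where "\<alpha> = 3 * s + a"
  define \<beta> where "\<beta> = 3 * s ^ 2 + 2 * a * s + b"
  define \<gamma> where "\<gamma> = s ^ 3 + a * s ^ 2 + b * s + c"
  have no_root': "x ^ 3 + \<alpha> * x ^ 2 + \<beta> * x + \<gamma> \<noteq> 0" for x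
  proof -
    have "x ^ 3 + \<alpha> * x ^ 2 + \<beta> * x + \<gamma> = (x + s) ^ 3 + a * (x + s) ^ 2 + b * (x + s) + c"
      unfolding \<alpha>_def \<beta>_def \<gamma>_def by algebra
    then show ?thesis
      using no_root by simp
  qed
  have \<alpha>: "0 \<le> v \<alpha>" and \<beta>: "0 \<le> v \<beta>" and \<gamma>: "0 < v \<gamma>"
    unfolding \<alpha>_def \<beta>_def \<gamma>_def using a b s root by (auto intro!: ring_nonneg)
  have \<beta>_pos: "0 < v \<beta>"
  proof (rule ccontr)
    assume "\<not> ?thesis"
    then have "v \<beta> = 0"
      using \<beta> by simp
    from Hensel_cubic[of 1, OF _ \<alpha> this \<gamma>] show False
      using no_root' by simp
  qed
  have \<alpha>_pos: "0 < v \<alpha>"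
  proof (rule ccontr)
    assume "\<not> ?thesis"
    then have "v \<alpha> = 0"
      using \<alpha> by simp
    \<comment> \<open>The expansion around \<open>s - \<alpha>\<close>; its linear coefficient is \<open>3 \<alpha>\<^sup>2 - 2 \<alpha>\<^sup>2 + \<beta>\<close>.\<close>
    then have lin: "v (\<alpha> ^ 2 + \<beta>) = 0"
      using add_eq[of "\<alpha> ^ 2" \<beta>] \<beta>_pos by (simp add: square)
    have "\<exists>u. 1 * u ^ 3 + (- 2 * \<alpha>) * u ^ 2 + (\<alpha> ^ 2 + \<beta>) * u + (\<gamma> - \<alpha> * \<beta>) = 0"
      using \<alpha> \<beta>_pos \<gamma> by (intro Hensel_cubic lin diff_gt mult_pos' ring_nonneg) (auto simp: numeral_nonneg)
    then obtain u where u: "1 * u ^ 3 + (- 2 * \<alpha>) * u ^ 2 + (\<alpha> ^ 2 + \<beta>) * u + (\<gamma> - \<alpha> * \<beta>) = 0"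
      by blast
    have "(u - \<alpha>) ^ 3 + \<alpha> * (u - \<alpha>) ^ 2 + \<beta> * (u - \<alpha>) + \<gamma> = 0"
      using u by algebra
    then show False
      using no_root' by blast
  qed
  have "c + s ^ 3 = \<alpha> * s ^ 2 - \<beta> * s + \<gamma>"
    unfolding \<alpha>_def \<beta>_def \<gamma>_def by algebra
  also have "0 < v \<dots>"
    using \<alpha>_pos \<beta>_pos \<gamma> s by (intro add_gt diff_gt mult_pos ring_nonneg) auto
  finally show ?thesis
    by simp
qed

end

section \<open>Field embeddings\<close>

context
  fixes f :: "'a::field \<Rightarrow> 'b::field"
  assumes f: "field_emb f"
begin

lemma
  shows field_emb_0: "f 0 = 0" and field_emb_1: "f 1 = 1"
    and field_emb_add: "f (x + y) = f x + f y" and field_emb_mult: "f (x * y) = f x * f y"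
  using f unfolding field_emb_def by blast+

lemma field_emb_minus: "f (- x) = - f x"
  using field_emb_add[of x "- x"] field_emb_0 by (simp add: eq_neg_iff_add_eq_0 add.commute)

lemma field_emb_diff: "f (x - y) = f x - f y"
  using field_emb_add[of x "- y"] field_emb_minus by simp

lemma field_emb_power: "f (x ^ n) = f x ^ n"
  by (induction n) (simp_all add: field_emb_1 field_emb_mult)

lemma field_emb_of_nat: "f (of_nat n) = of_nat n"
  by (induction n) (simp_all add: field_emb_0 field_emb_1 field_emb_add)

lemma field_emb_numeral: "f (numeral n) = numeral n"
  using field_emb_of_nat[of "numeral n"] by simp

lemma field_emb_eq_0_iff: "f x = 0 \<longleftrightarrow> x = 0"
proof
  show "x = 0" if "f x = 0"
  proof (rule ccontr)
    assume "x \<noteq> 0"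
    then have "f x * f (inverse x) = 1"
      using field_emb_mult[of x "inverse x"] field_emb_1 by simp
    with that show False
      by simp
  qed
qed (simp add: field_emb_0)

lemma field_emb_inverse: "f (inverse x) = inverse (f x)"
proof (cases "x = 0")
  case False
  then have "f x * f (inverse x) = 1"
    using field_emb_mult[of x "inverse x"] field_emb_1 by simp
  then show ?thesis
    by (metis inverse_unique)
qed (simp add: field_emb_0)

lemma field_emb_divide: "f (x / y) = f x / f y"
  by (simp add: divide_inverse field_emb_mult field_emb_inverse)

lemmas field_emb_simps = field_emb_0 field_emb_1 field_emb_add field_emb_mult field_emb_minus
  field_emb_diff field_emb_power field_emb_numeral field_emb_eq_0_iff field_emb_inverse
  field_emb_divide

end

section \<open>Closed subspaces over a complete field\<close>

definition val_closed :: "('a::field \<Rightarrow> ereal) \<Rightarrow> 'a set \<Rightarrow> bool" where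
  "val_closed w S \<longleftrightarrow> (\<forall>s l. (\<forall>n. s n \<in> S) \<and> val_tendsto w s l \<longrightarrow> l \<in> S)"

context valuation
begin

lemma tendsto_unique:
  assumes "val_tendsto v s l" "val_tendsto v s l'"
  shows "l = l'"
proof -
  have "l - l' = 0"
  proof (rule eq_zeroI)
    fix M :: real
    obtain N N' where N: "\<And>n. n \<ge> N \<Longrightarrow> ereal M \<le> v (s n - l)" "\<And>n. n \<ge> N' \<Longrightarrow> ereal M \<le> v (s n - l')"
      using assms unfolding val_tendsto_def by blast
    have "ereal M \<le> v ((s (max N N') - l') - (s (max N N') - l))"
      using N by (intro diff_ge[of _ "s (max N N') - l'"]) auto
    then show "ereal M \<le> v (l - l')"
      by simp
  qed
  then show ?thesis
    by simp
qed

lemma closed_dense: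
  assumes "val_closed v S" "val_dense v D" "D \<subseteq> S"
  shows "S = UNIV"
proof -
  have "l \<in> S" for l
  proof -
    have "\<forall>n::nat. \<exists>s\<in>D. ereal (real n) \<le> v (l - s)"
      using assms(2) unfolding val_dense_def by blast
    then obtain s where "\<And>n::nat. s n \<in> D \<and> ereal (real n) \<le> v (l - s n)"
      by metis
    then show ?thesis
      using assms(1,3) tendsto_const_close[of l s] unfolding val_closed_def by blast
  qed
  then show ?thesis
    by blast
qed

lemma zero_closed: "val_closed v {0}"
  unfolding val_closed_def
proof safe
  fix s l
  assume s: "\<forall>n::nat. s n \<in> {0}" and l: "val_tendsto v s l"
  have "val_tendsto v s 0"
    using s by (auto simp: val_tendsto_def)
  then show "l = 0"
    using l tendsto_unique by blast
qed

end

locale complete_extension = G: complete_valuation wg + H: complete_valuation wh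
  for wg :: "'g::field \<Rightarrow> ereal" and wh :: "'h::field \<Rightarrow> ereal" +
  fixes i :: "'g \<Rightarrow> 'h"
  assumes emb: "field_emb i" and isom: "wh (i x) = wg x"
begin

lemmas i_simps = field_emb_simps[OF emb]

text \<open>Finite-dimensional subspaces are closed, one generator at a time: the distance of the new
  generator \<open>z\<close> to the closed subspace \<open>S\<close> is positive, so that the coefficient of \<open>z\<close> depends
  continuously on the vector.\<close>

lemma closed_adjoin:
  assumes closed: "val_closed wh S" and zero: "0 \<in> S"
    and diff: "\<And>x y. x \<in> S \<Longrightarrow> y \<in> S \<Longrightarrow> x - y \<in> S"
    and scale: "\<And>g x. x \<in> S \<Longrightarrow> i g * x \<in> S"
  shows "val_closed wh {x + i g * z | x g. x \<in> S}" (is "val_closed wh ?T")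
proof (cases "z \<in> S")
  case True
  have add: "x + y \<in> S" if "x \<in> S" "y \<in> S" for x y
    using diff[OF that(1) diff[OF zero that(2)]] by simp
  have "?T = S"
  proof
    show "?T \<subseteq> S"
      using add scale True by blast
    show "S \<subseteq> ?T"
    proof
      fix x assume "x \<in> S"
      moreover have "x = x + i 0 * z"
        by (simp add: i_simps)
      ultimately show "x \<in> ?T"
        by blast
    qed
  qed
  with closed show ?thesis
    by simp
next
  case False
  have "\<exists>d::real. \<forall>x\<in>S. \<not> ereal d \<le> wh (z - x)"
  proof (rule ccontr)
    assume "\<not> ?thesis"
    then have "\<forall>n::nat. \<exists>x\<in>S. ereal (real n) \<le> wh (z - x)"
      by blast
    then obtain s where "\<And>n::nat. s n \<in> S \<and> ereal (real n) \<le> wh (z - s n)"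
      by metis
    then show False
      using False closed H.tendsto_const_close[of z s] unfolding val_closed_def by blast
  qed
  then obtain d :: real where d: "\<And>x. x \<in> S \<Longrightarrow> \<not> ereal d \<le> wh (z - x)"
    by blast
  have bound: "ereal (M - d) \<le> wg g" if x: "x \<in> S" and M: "ereal M \<le> wh (x + i g * z)" for x g M
  proof (cases "g = 0")
    case False
    then obtain \<gamma> where \<gamma>: "wg g = ereal \<gamma>"
      using G.finite_val by blast
    have "0 - i (inverse g) * x \<in> S"
      using x by (intro diff scale zero)
    from d[OF this] have lt: "wh (z + i (inverse g) * x) < ereal d"
      by simp
    have "x + i g * z = i g * (z + i (inverse g) * x)"
      using False by (simp add: i_simps field_simps)
    then have "wh (x + i g * z) = ereal \<gamma> + wh (z + i (inverse g) * x)"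
      using isom \<gamma> by (simp add: H.mult)
    with lt M have "M < \<gamma> + d"
      by (cases "wh (z + i (inverse g) * x)") auto
    then show ?thesis
      using \<gamma> by simp
  qed simp
  show ?thesis
    unfolding val_closed_def
  proof safe
    fix s l
    assume s: "\<forall>n. s n \<in> ?T" and l: "val_tendsto wh s l"
    from s have "\<forall>n. \<exists>x g. s n = x + i g * z \<and> x \<in> S"
      by blast
    then obtain x g where xg: "\<And>n. s n = x n + i (g n) * z" "\<And>n. x n \<in> S"
      by metis
    have "val_Cauchy wg g"
      unfolding val_Cauchy_def
    proof
      fix M :: real
      obtain N where N: "\<And>m n. m \<ge> N \<Longrightarrow> n \<ge> N \<Longrightarrow> ereal (M + d) \<le> wh (s m - s n)"
        using H.tendsto_Cauchy[OF l] unfolding val_Cauchy_def by blast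
      have "ereal (M + d - d) \<le> wg (g m - g n)" if "m \<ge> N" "n \<ge> N" for m n
      proof (rule bound)
        show "x m - x n \<in> S"
          by (intro diff xg)
        have "s m - s n = x m - x n + i (g m - g n) * z"
          unfolding xg by (simp add: i_simps algebra_simps)
        then show "ereal (M + d) \<le> wh (x m - x n + i (g m - g n) * z)"
          using N[OF that] by simp
      qed
      then show "\<exists>N. \<forall>m\<ge>N. \<forall>n\<ge>N. ereal M \<le> wg (g m - g n)"
        by auto
    qed
    then obtain \<gamma> where \<gamma>: "val_tendsto wg g \<gamma>"
      using G.complete unfolding val_complete_def by blast
    have "z \<noteq> 0"
      using False zero by blast
    then obtain \<zeta> where \<zeta>: "wh z = ereal \<zeta>"
      using H.finite_val by blast
    have "val_tendsto wh x (l - i \<gamma> * z)"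
      unfolding val_tendsto_def
    proof
      fix M :: real
      obtain N N' where N: "\<And>n. n \<ge> N \<Longrightarrow> ereal M \<le> wh (s n - l)"
          "\<And>n. n \<ge> N' \<Longrightarrow> ereal (M - \<zeta>) \<le> wg (g n - \<gamma>)"
        using l \<gamma> unfolding val_tendsto_def by metis
      have "ereal M \<le> wh (x n - (l - i \<gamma> * z))" if n: "n \<ge> max N N'" for n
      proof -
        have "ereal (M - \<zeta> + \<zeta>) \<le> wh (i (g n - \<gamma>) * z)"
          using N(2)[of n] n \<zeta> isom by (intro H.mult_ge) auto
        then have "ereal M \<le> wh ((s n - l) - i (g n - \<gamma>) * z)"
          using N(1)[of n] n by (intro H.diff_ge[of _ "s n - l"]) auto
        then show ?thesis
          unfolding xg by (simp add: i_simps algebra_simps)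
      qed
      then show "\<exists>N. \<forall>n\<ge>N. ereal M \<le> wh (x n - (l - i \<gamma> * z))"
        by blast
    qed
    then have "l - i \<gamma> * z \<in> S"
      using closed xg(2) unfolding val_closed_def by blast
    moreover have "l = (l - i \<gamma> * z) + i \<gamma> * z"
      by simp
    ultimately show "\<exists>x g. l = x + i g * z \<and> x \<in> S"
      by blast
  qed
qed

lemma span_1_z_z2_closed:
  "val_closed wh {i p + i q * z + i r * z ^ 2 | p q r. True}"
proof -
  define S0 where "S0 = {i p | p. True}"
  define S1 where "S1 = {i p + i q * z | p q. True}"
  have "{x + i g * 1 | x g. x \<in> {0}} = S0"
    unfolding S0_def by auto
  then have c0: "val_closed wh S0"
    using closed_adjoin[OF H.zero_closed, of 1] by simp
  have "{x + i g * z | x g. x \<in> S0} = S1"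
    unfolding S0_def S1_def by blast
  moreover have "val_closed wh {x + i g * z | x g. x \<in> S0}"
    by (intro closed_adjoin c0) (force simp: S0_def i_simps[symmetric])+
  ultimately have c1: "val_closed wh S1"
    by simp
  have "{x + i g * z ^ 2 | x g. x \<in> S1} = {i p + i q * z + i r * z ^ 2 | p q r. True}"
    unfolding S1_def by blast
  moreover have "val_closed wh {x + i g * z ^ 2 | x g. x \<in> S1}"
  proof (intro closed_adjoin c1)
    have "i 0 + i 0 * z \<in> S1"
      unfolding S1_def by blast
    then show "0 \<in> S1"
      by (simp add: i_simps)
    show "x - y \<in> S1" if xy: "x \<in> S1" "y \<in> S1" for x y
    proof -
      obtain p q p' q' where "x = i p + i q * z" "y = i p' + i q' * z"
        using xy unfolding S1_def by blast
      then have "x - y = i (p - p') + i (q - q') * z"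
        by (simp add: i_simps algebra_simps)
      then show ?thesis
        unfolding S1_def by blast
    qed
    show "i g * x \<in> S1" if x: "x \<in> S1" for g x
    proof -
      obtain p q where "x = i p + i q * z"
        using x unfolding S1_def by blast
      then have "i g * x = i (g * p) + i (g * q) * z"
        by (simp add: i_simps algebra_simps)
      then show ?thesis
        unfolding S1_def by blast
    qed
  qed
  ultimately show ?thesis
    by simp
qed

end

section \<open>Cubic extensions generated by one element\<close>

locale cubic_root =
  fixes i :: "'g::field \<Rightarrow> 'h::field" and z :: 'h and a b c :: 'g
  assumes emb: "field_emb i" and root: "z ^ 3 + i a * z ^ 2 + i b * z + i c = 0"
begin

lemmas i_simps = field_emb_simps[OF emb]

definition "Span = {i p + i q * z + i r * z ^ 2 | p q r. True}"

lemma SpanI: "x = i p + i q * z + i r * z ^ 2 \<Longrightarrow> x \<in> Span"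
  unfolding Span_def by blast

lemma Span_base: "i p \<in> Span"
  by (rule SpanI[of _ p 0 0]) (simp add: i_simps)

lemma Span_z: "z \<in> Span"
  by (rule SpanI[of _ 0 1 0]) (simp add: i_simps)

lemma Span_diff:
  assumes "x \<in> Span" "y \<in> Span"
  shows "x - y \<in> Span"
proof -
  obtain p q r p' q' r' where "x = i p + i q * z + i r * z ^ 2" "y = i p' + i q' * z + i r' * z ^ 2"
    using assms unfolding Span_def by blast
  then show ?thesis
    by (intro SpanI[of _ "p - p'" "q - q'" "r - r'"]) (simp add: i_simps algebra_simps)
qed

text \<open>Division with remainder by the cubic; the quotient is \<open>k\<^sub>1 T + k\<^sub>0\<close>.\<close>

lemma coords_mult:
  fixes p q r p' q' r' k0 k1
  defines "k1 \<equiv> r * r'" and "k0 \<equiv> q * r' + r * q' - a * (r * r')"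
  shows "(i p + i q * z + i r * z ^ 2) * (i p' + i q' * z + i r' * z ^ 2) =
    i (p * p' - c * k0) + i (p * q' + q * p' - b * k0 - c * k1) * z
      + i (p * r' + q * q' + r * p' - a * k0 - b * k1) * z ^ 2"
  unfolding k0_def k1_def i_simps using root by algebra

lemma Span_mult: "x \<in> Span \<Longrightarrow> y \<in> Span \<Longrightarrow> x * y \<in> Span"
  unfolding Span_def using coords_mult by blast

text \<open>The characteristic polynomial \<open>X\<^sup>3 - e\<^sub>1 X\<^sup>2 + e\<^sub>2 X - e\<^sub>3\<close> of multiplication by \<open>x\<close> vanishes at \<open>x\<close>.
  After division by the power of \<open>x\<close> that it contains, it expresses the inverse of \<open>x\<close> as a
  polynomial in \<open>x\<close>.\<close>

lemma Span_inverse: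
  assumes "x \<in> Span"
  shows "inverse x \<in> Span"
proof (cases "x = 0")
  case True
  then show ?thesis
    using Span_base[of 0] by (simp add: i_simps)
next
  case False
  obtain p q r where x: "x = i p + i q * z + i r * z ^ 2"
    using assms unfolding Span_def by blast
  define m where "m = q - r * a"
  define n where "n = p - r * b"
  define k where "k = r * c + b * m"
  define e1 where "e1 = p + n + (n - a * m)"
  define e2 where "e2 = p * n + q * r * c + p * (n - a * m) + r * c * m + n * (n - a * m) + m * k"
  define e3 where "e3 = p * (n * (n - a * m) + m * k) + r * c * (q * (n - a * m) + r * k)
      - c * m * (q * m - r * n)"
  have char: "x ^ 3 - i e1 * x ^ 2 + i e2 * x - i e3 = 0"
    unfolding x e1_def e2_def e3_def k_def n_def m_def i_simps using root by algebra
  have inv_mult: "inverse x \<in> Span" if "x * y = i e" "e \<noteq> 0" "y \<in> Span" for y e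
  proof -
    have "inverse x = i (inverse e) * y"
      using that(1,2) False by (simp add: i_simps field_simps)
    then show ?thesis
      using Span_mult Span_base that(3) by metis
  qed
  have add: "u + w \<in> Span" if "u \<in> Span" "w \<in> Span" for u w
    using Span_diff[OF that(1) Span_diff[OF Span_base[of 0] that(2)]] by (simp add: i_simps)
  show ?thesis
  proof (cases "e3 = 0")
    case False
    have "x * (x * x - i e1 * x + i e2) = i e3"
      using char by algebra
    then show ?thesis
      by (rule inv_mult) (intro False add Span_diff Span_mult Span_base assms)+
  next
    case e3: True
    then have "x * (x * (x - i e1) + i e2) = 0"
      using char by (simp add: i_simps power2_eq_square power3_eq_cube algebra_simps)
    then have char2: "x * (x - i e1) = i (- e2)"
      using False by (simp add: i_simps eq_neg_iff_add_eq_0)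
    show ?thesis
    proof (cases "e2 = 0")
      case False
      then show ?thesis
        by (intro inv_mult[OF char2] Span_diff Span_base assms) simp
    next
      case True
      then have "x = i e1"
        using char2 False by (simp add: i_simps)
      then show ?thesis
        using Span_base[of "inverse e1"] by (simp add: i_simps)
    qed
  qed
qed

text \<open>A root in the base field would put \<open>z\<close> into an extension of degree at most two.\<close>

lemma no_root_in_base:
  assumes deg: "0 < ext_degree i" "3 dvd ext_degree i" and gen: "Span = UNIV"
  shows "s ^ 3 + a * s ^ 2 + b * s + c \<noteq> 0"
proof
  assume s: "s ^ 3 + a * s ^ 2 + b * s + c = 0"
  interpret vs: vector_space "\<lambda>g x. i g * x"
    by unfold_locales (simp_all add: i_simps algebra_simps)
  have "\<exists>u v. z ^ 2 = i u + i v * z"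
  proof (cases "z = i s")
    case True
    then show ?thesis
      by (intro exI[of _ "s ^ 2"] exI[of _ 0]) (simp add: i_simps)
  next
    case False
    have "i (s ^ 3 + a * s ^ 2 + b * s + c) = 0"
      unfolding s by (simp add: i_simps)
    then have "(z - i s) * (z ^ 2 + (i s + i a) * z + (i s ^ 2 + i a * i s + i b)) = 0"
      using root unfolding i_simps by algebra
    then have "z ^ 2 + (i s + i a) * z + (i s ^ 2 + i a * i s + i b) = 0"
      using False by simp
    then have "z ^ 2 = i (- (s ^ 2 + a * s + b)) + i (- (s + a)) * z"
      unfolding i_simps by algebra
    then show ?thesis
      by blast
  qed
  then obtain u v where uv: "z ^ 2 = i u + i v * z"
    by blast
  have "x \<in> vs.span {1, z}" for x
  proof -
    obtain p q r where "x = i p + i q * z + i r * z ^ 2"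
      using gen unfolding Span_def by blast
    then have "x = i (p + r * u) * 1 + i (q + r * v) * z"
      unfolding uv by (simp add: i_simps algebra_simps)
    moreover have "i e * w \<in> vs.span {1, z}" if "w \<in> {1, z}" for e w
      using vs.span_scale[OF vs.span_base[OF that]] .
    ultimately show ?thesis
      by (metis insertCI vs.span_add)
  qed
  then have "vs.dim UNIV \<le> card {1, z}"
    by (intro vs.dim_le_card) auto
  also have "\<dots> \<le> 2"
    by (simp add: card_insert_if)
  finally have "ext_degree i \<le> 2"
    unfolding ext_degree_def .
  then show False
    using deg dvd_imp_le by fastforce
qed

end

section \<open>Monogenic cubic extensions of valuation rings\<close>

text \<open>An extension generated by a root \<open>z\<close> of an integral cubic that is irreducible over the residue
  field. For a cubic, irreducibility is the absence of roots.\<close>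

locale residually_irreducible_cubic = cubic_root i z a b c + G: valuation wg + H: valuation wh
  for wg :: "'g::field \<Rightarrow> ereal" and wh :: "'h::field \<Rightarrow> ereal"
    and i :: "'g \<Rightarrow> 'h" and z :: 'h and a b c :: 'g +
  assumes isom: "wh (i x) = wg x"
    and a: "0 \<le> wg a" and b: "0 \<le> wg b" and c: "0 \<le> wg c"
    and no_residue_root: "0 \<le> wg s \<Longrightarrow> \<not> 0 < wg (s ^ 3 + a * s ^ 2 + b * s + c)"
    and Span_UNIV: "Span = UNIV"
begin

lemma coords:
  obtains p q r where "x = i p + i q * z + i r * z ^ 2"
  using Span_UNIV unfolding Span_def by blast

lemma z_integral: "0 \<le> wh z"
proof (rule ccontr)
  assume neg: "\<not> ?thesis"
  then obtain \<zeta> where \<zeta>: "wh z = ereal \<zeta>"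
    using H.not_minf[of z] by (cases "wh z") auto
  with neg have "\<zeta> < 0"
    by simp
  have i_int: "ereal 0 \<le> wh (i x)" if "0 \<le> wg x" for x
    using that isom by (simp add: zero_ereal_def)
  have "ereal (0 + 2 * \<zeta>) \<le> wh (i a * z ^ 2)"
    using a H.power_ereal[OF \<zeta>, of 2] by (intro H.mult_ge i_int) auto
  moreover have "ereal (0 + \<zeta>) \<le> wh (i b * z)"
    using b \<zeta> by (intro H.mult_ge i_int) auto
  then have "ereal (0 + 2 * \<zeta>) \<le> wh (i b * z)"
    using \<open>\<zeta> < 0\<close> by (elim order_trans[rotated]) simp
  moreover have "ereal (0 + 2 * \<zeta>) \<le> wh (i c)"
    using i_int[OF c] \<open>\<zeta> < 0\<close> by (elim order_trans[rotated]) simp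
  ultimately have "ereal (0 + 2 * \<zeta>) \<le> wh (- (i a * z ^ 2 + i b * z + i c))"
    by (simp only: H.minus H.add_ge)
  also have "- (i a * z ^ 2 + i b * z + i c) = z ^ 3"
    using root by algebra
  finally show False
    using H.power_ereal[OF \<zeta>, of 3] \<open>\<zeta> < 0\<close> by simp
qed

lemma no_residue_approx:
  assumes s: "0 \<le> wg s"
  shows "\<not> 0 < wh (z - i s)"
proof
  assume "0 < wh (z - i s)"
  then have "0 < wh ((z - i s) * - (z ^ 2 + z * i s + i s ^ 2 + i a * (z + i s) + i b))"
    using z_integral s a b isom
    by (intro H.mult_pos) (auto intro!: H.ring_nonneg simp only: H.minus)
  also have "(z - i s) * - (z ^ 2 + z * i s + i s ^ 2 + i a * (z + i s) + i b) =
      i (s ^ 3 + a * s ^ 2 + b * s + c)"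
    unfolding i_simps using root by algebra
  finally show False
    using no_residue_root[OF s] isom by simp
qed

text \<open>A relation of degree at most two modulo the maximal ideal would yield, by division with
  remainder, a linear factor of the cubic there.\<close>

lemma reduction_independent:
  assumes p: "0 \<le> wg p" and q: "0 \<le> wg q" and r: "0 \<le> wg r"
    and pos: "0 < wh (i p + i q * z + i r * z ^ 2)"
  shows "0 < wg p \<and> 0 < wg q \<and> 0 < wg r"
proof -
  have linear: "0 < wg p \<and> 0 < wg q"
    if p: "0 \<le> wg p" and q: "0 \<le> wg q" and pos: "0 < wh (i p + i q * z)" for p q
  proof -
    have "0 < wg q"
    proof (rule ccontr)
      assume "\<not> ?thesis"
      then have q0: "wg q = 0"
        using q by simp
      then have "q \<noteq> 0"
        by auto
      then have "z - i (- p / q) = (i p + i q * z) / i q"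
        by (simp add: i_simps field_simps)
      then have "0 < wh (z - i (- p / q))"
        using pos q0 isom by (simp add: H.divide_unit)
      then show False
        using no_residue_approx[of "- p / q"] p q0 by (simp add: G.divide_unit del: minus_divide_left)
    qed
    moreover from this have "0 < wh (i p + i q * z - i q * z)"
      using pos z_integral isom by (intro H.diff_gt H.mult_pos) auto
    ultimately show ?thesis
      using isom by simp
  qed
  have r_pos: "0 < wg r"
  proof (rule ccontr)
    assume "\<not> ?thesis"
    then have r0: "wg r = 0"
      using r by simp
    then have "r \<noteq> 0"
      by auto
    define p' where "p' = p / r"
    define q' where "q' = q / r"
    have p': "0 \<le> wg p'" and q': "0 \<le> wg q'"
      unfolding p'_def q'_def using p q r0 by (simp_all add: G.divide_unit)
    define \<rho> where "\<rho> = i p' + i q' * z + z ^ 2"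
    have "\<rho> = (i p + i q * z + i r * z ^ 2) / i r"
      unfolding \<rho>_def p'_def q'_def using \<open>r \<noteq> 0\<close> by (simp add: i_simps add_divide_distrib)
    then have \<rho>: "0 < wh \<rho>"
      using pos r0 isom by (simp add: H.divide_unit)
    \<comment> \<open>The quotient \<open>T + e\<close> and the remainder \<open>R\<^sub>1 T + R\<^sub>0\<close> of the cubic.\<close>
    define e where "e = a - q'"
    define R1 where "R1 = b - p' - q' * e"
    define R0 where "R0 = c - p' * e"
    have ints: "0 \<le> wg e" "0 \<le> wg R1" "0 \<le> wg R0"
      unfolding e_def R1_def R0_def using a b c p' q' by (auto intro!: G.ring_nonneg)
    have "i R0 + i R1 * z = - \<rho> * (z + i e)"
      unfolding R0_def R1_def e_def \<rho>_def i_simps using root by algebra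
    moreover have "0 < wh (- \<rho> * (z + i e))"
      using \<rho> z_integral ints isom by (intro H.mult_pos H.add_ge) auto
    ultimately have "0 < wg R0 \<and> 0 < wg R1"
      using ints by (intro linear) auto
    then have "0 < wg (R1 * (- e) + R0)"
      using ints by (intro G.add_gt G.mult_pos) auto
    also have "R1 * (- e) + R0 = (- e) ^ 3 + a * (- e) ^ 2 + b * (- e) + c"
      unfolding R1_def R0_def e_def by algebra
    finally show False
      using no_residue_root[of "- e"] ints by simp
  qed
  have "0 < wh (i p + i q * z + i r * z ^ 2 - i r * z ^ 2)"
    using pos r_pos z_integral isom by (intro H.diff_gt H.mult_pos H.ring_nonneg) auto
  with linear[OF p q] r_pos show ?thesis
    by simp
qed

text \<open>Dividing by a coefficient of minimal valuation reduces orthogonality of the basis to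
  independence modulo the maximal ideal.\<close>

lemma basis_orthogonal: "wh (i p + i q * z + i r * z ^ 2) = min (wg p) (min (wg q) (wg r))"
proof (rule antisym)
  let ?m = "min (wg p) (min (wg q) (wg r))"
  let ?e = "i p + i q * z + i r * z ^ 2"
  have le: "?m \<le> wh (i x * z ^ n)" if "?m \<le> wg x" for x n
    using that H.power_nonneg[OF z_integral, of n] isom
    by (metis H.mult add_increasing2)
  have "?m \<le> wh (i p * z ^ 0 + i q * z ^ 1 + i r * z ^ 2)"
    by (intro H.add_ge le) (auto intro: min.coboundedI1 min.coboundedI2)
  then show "?m \<le> wh ?e"
    by simp
  have "\<exists>d\<in>{p, q, r}. wg d = ?m"
    by (simp add: min_def)
  then obtain d where d: "d \<in> {p, q, r}" "wg d = ?m"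
    by blast
  show "wh ?e \<le> ?m"
  proof (cases "d = 0")
    case True
    with d show ?thesis
      by simp
  next
    case False
    then obtain \<delta> where \<delta>: "wg d = ereal \<delta>"
      using G.finite_val by blast
    have quot: "0 \<le> wg (x / d)" if "x \<in> {p, q, r}" for x
    proof (cases "x = 0")
      case x0: False
      then obtain \<xi> where \<xi>: "wg x = ereal \<xi>"
        using G.finite_val by blast
      have "wg d \<le> wg x"
        using that d(2) by (auto intro: min.coboundedI1 min.coboundedI2)
      then show ?thesis
        using False \<xi> \<delta> by (simp add: G.divide_ereal)
    qed simp
    have "\<not> (0 < wg (p / d) \<and> 0 < wg (q / d) \<and> 0 < wg (r / d))"
      using d(1) False by auto
    then have "\<not> 0 < wh (i (p / d) + i (q / d) * z + i (r / d) * z ^ 2)"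
      using reduction_independent quot by blast
    moreover have "?e = i d * (i (p / d) + i (q / d) * z + i (r / d) * z ^ 2)"
      using False by (simp add: i_simps field_simps)
    ultimately have "wh ?e \<le> wh (i d) + 0"
      unfolding H.mult by (metis add_left_mono not_less H.mult)
    then show ?thesis
      using d(2) isom by simp
  qed
qed

section \<open>The different of a monogenic cubic extension\<close>

abbreviation "OG \<equiv> i ` val_ring wg"
abbreviation "OH \<equiv> val_ring wh"

lemma OH_closed:
  shows "x \<in> OH \<Longrightarrow> y \<in> OH \<Longrightarrow> x + y \<in> OH" "x \<in> OH \<Longrightarrow> y \<in> OH \<Longrightarrow> x - y \<in> OH"
    "x \<in> OH \<Longrightarrow> y \<in> OH \<Longrightarrow> x * y \<in> OH" "x \<in> OH \<Longrightarrow> - x \<in> OH"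
    "x \<in> OH \<Longrightarrow> x ^ n \<in> OH" "numeral k \<in> OH" "1 \<in> OH" "0 \<in> OH" "z \<in> OH" "OG \<subseteq> OH"
  using z_integral isom
  by (auto simp: val_ring_def H.add_ge H.diff_ge H.mult_nonneg H.power_nonneg H.numeral_nonneg)

lemma integral_coords:
  assumes "x \<in> OH"
  obtains p q r where "x = i p + i q * z + i r * z ^ 2" "0 \<le> wg p" "0 \<le> wg q" "0 \<le> wg r"
  using coords[of x] assms basis_orthogonal by (metis min.bounded_iff mem_Collect_eq val_ring_def)

text \<open>The derivative of the cubic at \<open>z\<close>.\<close>

definition "F' = 3 * z ^ 2 + 2 * i a * z + i b"

lemma F'_integral: "F' \<in> OH"
  unfolding F'_def using a b isom
  by (intro OH_closed(1,3,5,6,9)) (auto simp: val_ring_def)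

lemma val_F':
  assumes three: "0 < wg 3"
  shows "wh F' = min (wg 3) (min (wg a) (wg b))"
proof -
  have "F' = i b + i (2 * a) * z + i 3 * z ^ 2"
    unfolding F'_def i_simps by (simp add: algebra_simps)
  then have "wh F' = min (wg b) (min (wg (2 * a)) (wg 3))"
    by (simp only: basis_orthogonal)
  then show ?thesis
    using G.two_unit[OF three] by (simp add: G.mult ac_simps)
qed

subsection \<open>Generation of the differentials by \<open>dz\<close>\<close>

abbreviation "R \<equiv> kaehler_rel OG OH"

lemma map_single: "Poly_Mapping.map ((*) (u::'h)) (Poly_Mapping.single x w) = Poly_Mapping.single x (u * w)"
  by (rule poly_mapping_eqI) (simp add: map.rep_eq lookup_single when_def)

lemma map_diff: "Poly_Mapping.map ((*) (u::'h)) (p - q) = Poly_Mapping.map ((*) u) p - Poly_Mapping.map ((*) u) q"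
  by (rule poly_mapping_eqI) (simp add: map.rep_eq lookup_minus when_def algebra_simps)

lemma rel_minus: "p \<in> R \<Longrightarrow> q \<in> R \<Longrightarrow> p - q \<in> R"
proof -
  assume p: "p \<in> R" and q: "q \<in> R"
  have "Poly_Mapping.map ((*) (- 1)) q \<in> R"
    using q OH_closed by (intro kaehler_rel.scale) auto
  moreover have "Poly_Mapping.map ((*) (- 1)) q = - q"
    by (rule poly_mapping_eqI) (simp add: map.rep_eq when_def)
  ultimately show ?thesis
    using kaehler_rel.plus[OF p] by (metis diff_conv_add_uminus)
qed

text \<open>The equation \<open>dx = w dz\<close> in the module of differentials.\<close>

definition "differential_is x w \<longleftrightarrow>
  x \<in> OH \<and> w \<in> OH \<and> Poly_Mapping.single x 1 - Poly_Mapping.single z w \<in> R"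

lemma differential_base: "0 \<le> wg x \<Longrightarrow> differential_is (i x) 0"
  unfolding differential_is_def using OH_closed(8,10) kaehler_rel.d_base[of "i x" OG OH]
  by (auto simp: val_ring_def isom)

lemma differential_z: "differential_is z 1"
  unfolding differential_is_def using OH_closed kaehler_rel.zero by auto

lemma differential_add:
  assumes "differential_is x u" "differential_is y w"
  shows "differential_is (x + y) (u + w)"
proof -
  have "(Poly_Mapping.single (x + y) 1 - Poly_Mapping.single x 1 - Poly_Mapping.single y 1)
      + (Poly_Mapping.single x 1 - Poly_Mapping.single z u)
      + (Poly_Mapping.single y 1 - Poly_Mapping.single z w) \<in> R"
    using assms unfolding differential_is_def
    by (intro kaehler_rel.plus kaehler_rel.d_add) auto
  then show ?thesis
    using assms OH_closed unfolding differential_is_def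
    by (simp add: single_add algebra_simps)
qed

lemma differential_mult:
  assumes "differential_is x u" "differential_is y w"
  shows "differential_is (x * y) (x * w + y * u)"
proof -
  have "(Poly_Mapping.single (x * y) 1 - Poly_Mapping.single y x - Poly_Mapping.single x y)
      + Poly_Mapping.map ((*) y) (Poly_Mapping.single x 1 - Poly_Mapping.single z u)
      + Poly_Mapping.map ((*) x) (Poly_Mapping.single y 1 - Poly_Mapping.single z w) \<in> R"
    using assms unfolding differential_is_def
    by (intro kaehler_rel.plus kaehler_rel.d_mult kaehler_rel.scale) auto
  then show ?thesis
    using assms OH_closed unfolding differential_is_def
    by (simp add: single_add algebra_simps map_diff map_single)
qed

lemma differential_coords:
  assumes "0 \<le> wg p" "0 \<le> wg q" "0 \<le> wg r"
  shows "differential_is (i p + i q * z + i r * z ^ 2) (i q + 2 * i r * z)"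
proof -
  have "differential_is (i p + i q * z + i r * (z * z))
      (0 + (i q * 1 + z * 0) + (i r * (z * 1 + z * 1) + z * z * 0))"
    by (intro differential_add differential_mult differential_z differential_base assms)
  then show ?thesis
    by (simp add: power2_eq_square algebra_simps)
qed

text \<open>The rules of differentiation, applied to the cubic equation of \<open>z\<close>, give \<open>F'(z) dz = d0 = 0\<close>.\<close>

lemma F'_kills_dz: "Poly_Mapping.single z F' \<in> R"
proof -
  have "differential_is (z * (z * z) + i a * (z * z) + i b * z + i c)
      ((z * (z * 1 + z * 1) + z * z * 1) + (i a * (z * 1 + z * 1) + z * z * 0) + (i b * 1 + z * 0) + 0)"
    by (intro differential_add differential_mult differential_z differential_base a b c)
  moreover have "z * (z * z) + i a * (z * z) + i b * z + i c = i 0"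
    using root by (simp add: power2_eq_square power3_eq_cube i_simps mult.assoc)
  moreover have "(z * (z * 1 + z * 1) + z * z * 1) + (i a * (z * 1 + z * 1) + z * z * 0) + (i b * 1 + z * 0) + 0 = F'"
    unfolding F'_def by (simp add: power2_eq_square algebra_simps)
  ultimately have "Poly_Mapping.single (i 0) 1 - Poly_Mapping.single z F' \<in> R"
    unfolding differential_is_def by metis
  moreover have "Poly_Mapping.single (i 0) 1 \<in> R"
    by (intro kaehler_rel.d_base) (auto simp: val_ring_def)
  ultimately show ?thesis
    using rel_minus by fastforce
qed

lemma F'_annihilates: "annihilates_kaehler OG OH F'"
  unfolding annihilates_kaehler_def
proof
  fix \<omega> assume \<omega>: "\<omega> \<in> kaehler_free OH"
  have single: "Poly_Mapping.single x (F' * w) \<in> R" if x: "x \<in> OH" and w: "w \<in> OH" for x w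
  proof -
    obtain p q r where "x = i p + i q * z + i r * z ^ 2" "0 \<le> wg p" "0 \<le> wg q" "0 \<le> wg r"
      using integral_coords[OF x] .
    then have "differential_is x (i q + 2 * i r * z)"
      using differential_coords by blast
    then obtain u where u: "u \<in> OH" "Poly_Mapping.single x 1 - Poly_Mapping.single z u \<in> R"
      unfolding differential_is_def by blast
    have "Poly_Mapping.map ((*) (F' * w)) (Poly_Mapping.single x 1 - Poly_Mapping.single z u)
        + Poly_Mapping.map ((*) (u * w)) (Poly_Mapping.single z F') \<in> R"
      using u w by (intro kaehler_rel.plus kaehler_rel.scale F'_kills_dz OH_closed F'_integral)
    then show ?thesis
      by (simp add: map_diff map_single mult.assoc mult.left_commute mult.commute)
  qed
  have "Poly_Mapping.map ((*) F') \<omega> =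
      (\<Sum>x\<in>Poly_Mapping.keys \<omega>. Poly_Mapping.single x (F' * Poly_Mapping.lookup \<omega> x))"
    by (rule poly_mapping_eqI)
      (auto simp: map.rep_eq lookup_sum lookup_single when_def in_keys_iff)
  moreover have "(\<Sum>x\<in>A. Poly_Mapping.single x (F' * Poly_Mapping.lookup \<omega> x)) \<in> R"
    if "A \<subseteq> OH" for A
    using that \<omega> by (induction A rule: infinite_finite_induct)
      (auto simp: kaehler_free_def image_subset_iff intro!: kaehler_rel.zero kaehler_rel.plus single)
  ultimately show "Poly_Mapping.map ((*) F') \<omega> \<in> R"
    using \<omega> unfolding kaehler_free_def by auto
qed

subsection \<open>A derivation modulo \<open>F'(z)\<close>\<close>

text \<open>The derivative at \<open>z\<close> of the polynomial of degree at most two that represents \<open>x\<close>.\<close>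

definition "deriv_at_z x = (SOME w. \<exists>p q r. x = i p + i q * z + i r * z ^ 2 \<and> w = i q + 2 * i r * z)"

lemma coords_unique:
  assumes "i p + i q * z + i r * z ^ 2 = i p' + i q' * z + i r' * z ^ 2"
  shows "p = p' \<and> q = q' \<and> r = r'"
proof -
  have "i (p - p') + i (q - q') * z + i (r - r') * z ^ 2 = 0"
    using assms by (simp add: i_simps algebra_simps)
  then have "min (wg (p - p')) (min (wg (q - q')) (wg (r - r'))) = \<infinity>"
    by (metis basis_orthogonal H.zero)
  then have "wg (p - p') = \<infinity>" "wg (q - q') = \<infinity>" "wg (r - r') = \<infinity>"
    by (auto simp: min_def split: if_splits)
  then show ?thesis
    by simp
qed

lemma deriv_at_z: "deriv_at_z (i p + i q * z + i r * z ^ 2) = i q + 2 * i r * z"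
  unfolding deriv_at_z_def by (rule some_equality) (use coords_unique in blast)+

lemma deriv_at_z_add: "deriv_at_z (x + y) = deriv_at_z x + deriv_at_z y"
proof -
  obtain p q r where x: "x = i p + i q * z + i r * z ^ 2"
    using coords .
  obtain p' q' r' where y: "y = i p' + i q' * z + i r' * z ^ 2"
    using coords .
  have "x + y = i (p + p') + i (q + q') * z + i (r + r') * z ^ 2"
    unfolding x y by (simp add: i_simps algebra_simps)
  then have "deriv_at_z (x + y) = i (q + q') + 2 * i (r + r') * z"
    by (simp only: deriv_at_z)
  then show ?thesis
    unfolding x y deriv_at_z by (simp add: i_simps algebra_simps)
qed

lemma deriv_at_z_base: "deriv_at_z (i p) = 0"
  using deriv_at_z[of p 0 0] by (simp add: i_simps)

lemma deriv_at_z_z: "deriv_at_z z = 1"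
  using deriv_at_z[of 0 1 0] by (simp add: i_simps)

text \<open>Reducing a product modulo the cubic, with quotient \<open>k\<^sub>1 T + k\<^sub>0\<close>, changes the derivative at \<open>z\<close>
  by \<open>(k\<^sub>1 z + k\<^sub>0) F'(z)\<close>.\<close>

lemma deriv_at_z_mult:
  assumes x: "x \<in> OH" and y: "y \<in> OH"
  shows "\<exists>u\<in>OH. deriv_at_z (x * y) - x * deriv_at_z y - y * deriv_at_z x = F' * u"
proof -
  obtain p q r where x: "x = i p + i q * z + i r * z ^ 2" "0 \<le> wg p" "0 \<le> wg q" "0 \<le> wg r"
    using integral_coords[OF x] .
  obtain p' q' r' where y: "y = i p' + i q' * z + i r' * z ^ 2" "0 \<le> wg p'" "0 \<le> wg q'" "0 \<le> wg r'"
    using integral_coords[OF y] .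
  define k1 where "k1 = r * r'"
  define k0 where "k0 = q * r' + r * q' - a * k1"
  have "deriv_at_z (x * y) = i (p * q' + q * p' - b * k0 - c * k1)
      + 2 * i (p * r' + q * q' + r * p' - a * k0 - b * k1) * z"
    unfolding x y k0_def k1_def coords_mult deriv_at_z ..
  then have "deriv_at_z (x * y) - x * deriv_at_z y - y * deriv_at_z x = F' * - (i k1 * z + i k0)"
    unfolding x y deriv_at_z F'_def k0_def k1_def i_simps using root by algebra
  moreover have "i k1 \<in> OH" "i k0 \<in> OH"
    unfolding k0_def k1_def using x y a isom by (auto simp: val_ring_def intro!: G.ring_nonneg)
  then have "- (i k1 * z + i k0) \<in> OH"
    by (intro OH_closed)
  ultimately show ?thesis
    by blast
qed

text \<open>The map that \<open>deriv_at_z\<close> induces on the free module. It sends all relations into the ideal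
  \<open>(F'(z))\<close> and \<open>dz\<close> to \<open>1\<close>, so an annihilator of \<open>dz\<close> lies in this ideal.\<close>

definition "pairing \<omega> = (\<Sum>x\<in>Poly_Mapping.keys \<omega>. Poly_Mapping.lookup \<omega> x * deriv_at_z x)"

lemma pairing_superset:
  "finite S \<Longrightarrow> Poly_Mapping.keys \<omega> \<subseteq> S \<Longrightarrow> pairing \<omega> = (\<Sum>x\<in>S. Poly_Mapping.lookup \<omega> x * deriv_at_z x)"
  unfolding pairing_def by (rule sum.mono_neutral_left) (auto simp: in_keys_iff)

lemma pairing_add: "pairing (p + q) = pairing p + pairing q"
proof -
  let ?S = "Poly_Mapping.keys p \<union> Poly_Mapping.keys q"
  have "finite ?S" "Poly_Mapping.keys (p + q) \<subseteq> ?S"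
    by (auto simp: in_keys_iff lookup_add)
  then show ?thesis
    using pairing_superset[of ?S p] pairing_superset[of ?S q] pairing_superset[of ?S "p + q"]
    by (simp add: lookup_add distrib_right sum.distrib)
qed

lemma pairing_single: "pairing (Poly_Mapping.single x w) = w * deriv_at_z x"
  using pairing_superset[of "{x}" "Poly_Mapping.single x w"] by simp

lemma pairing_diff: "pairing (p - q) = pairing p - pairing q"
  using pairing_add[of "p - q" q] by simp

lemma pairing_scale: "pairing (Poly_Mapping.map ((*) u) p) = u * pairing p"
proof -
  have "Poly_Mapping.keys (Poly_Mapping.map ((*) u) p) \<subseteq> Poly_Mapping.keys p"
    by (auto simp: in_keys_iff map.rep_eq when_def)
  then show ?thesis
    using pairing_superset[of "Poly_Mapping.keys p" "Poly_Mapping.map ((*) u) p"]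
    by (auto simp: pairing_def sum_distrib_left map.rep_eq when_def in_keys_iff mult.assoc intro!: sum.cong)
qed

lemma pairing_rel: "p \<in> R \<Longrightarrow> \<exists>u\<in>OH. pairing p = F' * u"
proof (induction rule: kaehler_rel.induct)
  case zero
  then show ?case
    using OH_closed(8) by (intro bexI[of _ 0]) (auto simp: pairing_def)
next
  case (plus p q)
  then obtain u w where "u \<in> OH" "w \<in> OH" "pairing p = F' * u" "pairing q = F' * w"
    by blast
  then show ?case
    using OH_closed(1)[of u w] by (intro bexI[of _ "u + w"]) (auto simp: pairing_add algebra_simps)
next
  case (scale y p)
  then obtain u where "u \<in> OH" "pairing p = F' * u"
    by blast
  then show ?case
    using OH_closed(3)[of y u] scale by (intro bexI[of _ "y * u"]) (auto simp: pairing_scale)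
next
  case (d_add x y)
  then show ?case
    using OH_closed(8) by (intro bexI[of _ 0]) (auto simp: pairing_diff pairing_single deriv_at_z_add)
next
  case (d_mult x y)
  from deriv_at_z_mult[OF this] show ?case
    by (simp add: pairing_diff pairing_single)
next
  case (d_base x)
  then show ?case
    using OH_closed(8) by (intro bexI[of _ 0]) (auto simp: pairing_single deriv_at_z_base)
qed

lemma annihilates_imp_multiple:
  assumes "annihilates_kaehler OG OH y"
  shows "\<exists>u\<in>OH. y = F' * u"
proof -
  have "Poly_Mapping.single z 1 \<in> kaehler_free OH"
    using OH_closed by (auto simp: kaehler_free_def lookup_single when_def)
  then have "Poly_Mapping.map ((*) y) (Poly_Mapping.single z 1) \<in> R"
    using assms unfolding annihilates_kaehler_def by blast
  from pairing_rel[OF this] show ?thesis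
    by (simp add: map_single pairing_single deriv_at_z_z)
qed

text \<open>The annihilator of the differentials is the ideal generated by \<open>F'(z)\<close>, whose valuation is
  read off in the orthogonal basis.\<close>

lemma delta_eq:
  assumes three: "wg 3 = 1"
  shows "ereal (delta wg wh i) = 3 / 2 * min 1 (min (wg a) (wg b))"
proof -
  have val: "wh F' = min 1 (min (wg a) (wg b))"
    using val_F' three by simp
  then have "wh F' \<noteq> \<infinity>"
    by (auto simp: min_def)
  then have "F' \<noteq> 0"
    by simp
  then obtain f where f: "wh F' = ereal f"
    using H.finite_val by blast
  let ?S = "{y \<in> OH. annihilates_kaehler OG OH y}"
  have "delta_CTT wg wh i = val_abs wh F'"
    unfolding delta_CTT_def
  proof (rule cSup_eq_maximum)
    show "val_abs wh F' \<in> val_abs wh ` ?S"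
      using F'_integral F'_annihilates by blast
    show "s \<le> val_abs wh F'" if s: "s \<in> val_abs wh ` ?S" for s
    proof -
      obtain y where y: "s = val_abs wh y" "annihilates_kaehler OG OH y"
        using s by blast
      then obtain u where u: "u \<in> OH" "y = F' * u"
        using annihilates_imp_multiple by blast
      show ?thesis
      proof (cases "u = 0")
        case True
        then show ?thesis
          using u y by (simp add: val_abs_def)
      next
        case False
        then obtain g where g: "wh u = ereal g"
          using H.finite_val by blast
        then have "0 \<le> g"
          using u(1) by (simp add: val_ring_def)
        then show ?thesis
          unfolding y u(2) val_abs_def using False \<open>F' \<noteq> 0\<close> f g by (simp add: H.mult)
      qed
    qed
  qed
  also have "\<dots> = exp (- f)"
    using \<open>F' \<noteq> 0\<close> f by (simp add: val_abs_def)
  finally have "delta wg wh i = 3 / 2 * f"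
    by (simp add: delta_def)
  then show ?thesis
    using val f by (metis times_ereal.simps(1) ereal_divide numeral_eq_ereal zero_neq_numeral)
qed

end

section \<open>Gauss valuations\<close>

lemma in_t_simps:
  "in_t x0 0 = 0" "in_t x0 1 = 1" "in_t x0 (p + q) = in_t x0 p + in_t x0 q"
  "in_t x0 (p - q) = in_t x0 p - in_t x0 q" "in_t x0 (p * q) = in_t x0 p * in_t x0 q"
  by (simp_all add: in_t_def in_x_def pcompose_add pcompose_diff pcompose_mult pcompose_1 fract_collapse)

lemma in_t_power: "in_t x0 (p ^ n) = in_t x0 p ^ n"
  by (induction n) (simp_all add: in_t_simps)

lemma in_t_numeral: "in_t x0 (numeral n) = numeral n"
proof -
  have "in_t x0 (of_nat m) = of_nat m" for m
    by (induction m) (simp_all add: in_t_simps)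
  from this[of "numeral n"] show ?thesis
    by simp
qed

lemma in_t_eq_0_iff: "in_t x0 p = 0 \<longleftrightarrow> p = 0"
  by (auto simp: in_t_def in_x_def eq_fract pcompose_eq_0 Zero_fract_def)

lemma fract_as_in_t: "\<exists>p q. q \<noteq> 0 \<and> f = in_t x0 p / in_t x0 q"
proof -
  obtain P Q where f: "f = Fract P Q" "Q \<noteq> 0"
    by (cases f) auto
  have shift: "pcompose (pcompose p [:x0, 1:]) [:- x0, 1:] = p" for p
    by (simp add: pcompose_assoc[symmetric] pcompose_pCons)
  have "f = in_t x0 (pcompose P [:x0, 1:]) / in_t x0 (pcompose Q [:x0, 1:])"
    using f by (simp add: in_t_def in_x_def shift)
  moreover have "pcompose Q [:x0, 1:] \<noteq> 0"
    using f(2) shift[of Q] by auto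
  ultimately show ?thesis
    by blast
qed

locale gauss_valuation = K: valuation vK + X: valuation \<xi>
  for vK :: "'k::{alg_closed_field,field_char_0} \<Rightarrow> ereal" and \<xi> :: "'k poly fract \<Rightarrow> ereal" +
  fixes x0 :: 'k and r :: real
  assumes gauss: "\<xi> (in_t x0 d) = (MIN i\<in>{..degree d}. vK (coeff d i) + ereal (real i * r))"
    and vK_3: "vK 3 = 1" and r_rat: "r \<in> \<rat>"
begin

abbreviation "g d \<equiv> \<xi> (in_t x0 d)"

lemma g_ge_iff: "m \<le> g d \<longleftrightarrow> (\<forall>i. m \<le> vK (coeff d i) + ereal (real i * r))"
proof -
  have "m \<le> g d \<longleftrightarrow> (\<forall>i\<le>degree d. m \<le> vK (coeff d i) + ereal (real i * r))"
    by (auto simp: gauss)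
  also have "\<dots> \<longleftrightarrow> (\<forall>i. m \<le> vK (coeff d i) + ereal (real i * r))"
    by (metis K.zero coeff_eq_0 ereal_less_eq(1) leI plus_ereal.simps(2) PInfty_neq_ereal(1) ereal_plus_1(2))
  finally show ?thesis .
qed

lemma g_const: "g [:c:] = vK c"
  by (simp add: gauss)

lemma g_numeral: "g (numeral n) = vK (numeral n)"
  using g_const[of "numeral n"] by (simp add: numeral_poly)

lemma val_3: "\<xi> 3 = 1"
  using g_numeral[of "num.Bit1 num.One"] vK_3 by (simp add: in_t_numeral)

text \<open>The operator \<open>t d/dt\<close> multiplies coefficients by integers.\<close>

lemma g_t_pderiv: "g d \<le> g ([:0, 1:] * pderiv d)"
  unfolding g_ge_iff
proof
  fix n
  have "g d \<le> vK (coeff d n) + ereal (real n * r)"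
    using g_ge_iff[of "g d" d] by simp
  also have "\<dots> \<le> vK (of_nat n) + (vK (coeff d n) + ereal (real n * r))"
    using K.of_nat_nonneg by (metis add_increasing order_refl)
  also have "\<dots> = vK (coeff ([:0, 1:] * pderiv d) n) + ereal (real n * r)"
    by (cases n) (simp_all add: coeff_pderiv K.mult add.assoc)
  finally show "g d \<le> vK (coeff ([:0, 1:] * pderiv d) n) + ereal (real n * r)" .
qed

text \<open>Here these integers are the exponents \<open>1\<close>, \<open>2\<close> and \<open>4\<close>, which are units in residue
  characteristic \<open>3\<close>.\<close>

lemma g_t_pderiv_eq: "g ([:0, 1:] * pderiv [:0, c1, c2, 0, c4:]) = g [:0, c1, c2, 0, c4:]"
proof -
  have 2: "vK 2 = 0"
    using K.two_unit vK_3 by simp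
  have 4: "vK 4 = 0"
    using K.mult[of 2 2] 2 by simp
  have "vK (coeff ([:0, 1:] * pderiv [:0, c1, c2, 0, c4:]) n) = vK (coeff [:0, c1, c2, 0, c4:] n)" for n
  proof -
    have "[:0, 1:] * pderiv [:0, c1, c2, 0, c4:] = [:0, c1, 2 * c2, 0, 4 * c4:]"
      by (simp add: pderiv_pCons)
    then show ?thesis
      using 2 4 by (auto simp: coeff_pCons K.mult split: nat.splits)
  qed
  then show ?thesis
    using g_ge_iff by (metis order_antisym order_refl)
qed

text \<open>For \<open>f = P / Q\<close>, the operator \<open>t d/dt\<close> is applied to \<open>E = C Q\<^sup>3 + P\<^sup>3\<close>. If \<open>E\<close> were smaller than
  \<open>C Q\<^sup>3\<close>, so would be the image of \<open>E\<close> and, because of the factor \<open>3\<close>, all terms that come from a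
  derivative of \<open>P\<^sup>3\<close> or \<open>Q\<^sup>3\<close>. The remaining term \<open>t C' Q\<^sup>3\<close> is as large as \<open>C Q\<^sup>3\<close>.\<close>

lemma not_near_cube:
  assumes C: "C = [:0, c1, c2, 0, c4:]" and "C \<noteq> 0"
  shows "\<xi> (in_t x0 C + f ^ 3) \<le> g C"
proof (rule ccontr)
  assume "\<not> ?thesis"
  then have lt: "g C < \<xi> (in_t x0 C + f ^ 3)"
    by simp
  obtain P Q where "Q \<noteq> 0" and f: "f = in_t x0 P / in_t x0 Q"
    using fract_as_in_t by blast
  then have Q0: "in_t x0 Q \<noteq> 0"
    by (simp add: in_t_eq_0_iff)
  define E where "E = C * Q ^ 3 + P ^ 3"
  obtain q \<gamma> where q: "g Q = ereal q" and \<gamma>: "g C = ereal \<gamma>"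
    using Q0 \<open>C \<noteq> 0\<close> X.finite_val by (metis in_t_eq_0_iff)
  have gQ3: "g (Q ^ 3) = ereal (3 * q)"
    using X.power_ereal[OF q, of 3] by (simp add: in_t_power)
  have gCQ: "g (C * Q ^ 3) = ereal (\<gamma> + 3 * q)"
    using gQ3 \<gamma> by (simp add: in_t_simps X.mult)
  have "in_t x0 E = (in_t x0 C + f ^ 3) * in_t x0 (Q ^ 3)"
    unfolding E_def f using Q0 by (simp add: in_t_simps in_t_power field_simps)
  then have "g E = \<xi> (in_t x0 C + f ^ 3) + ereal (3 * q)"
    using gQ3 by (simp add: X.mult)
  then have E: "ereal (\<gamma> + 3 * q) < g E"
    using lt \<gamma> by (cases "\<xi> (in_t x0 C + f ^ 3)") auto
  have "P ^ 3 = E - C * Q ^ 3"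
    unfolding E_def by simp
  then have P: "ereal (\<gamma> + 3 * q) \<le> g (P ^ 3)"
    using X.diff_ge[of "ereal (\<gamma> + 3 * q)" "in_t x0 E" "in_t x0 (C * Q ^ 3)"] E gCQ
    by (simp add: in_t_simps)
  let ?t = "[:0, 1:] :: 'k poly"
  define N where "N = ?t * pderiv E - 3 * (C * Q ^ 2 * (?t * pderiv Q)) - 3 * (P ^ 2 * (?t * pderiv P))"
  have "?t * pderiv C * Q ^ 3 = N"
    unfolding N_def E_def
    by (simp add: pderiv_add pderiv_mult pderiv_power power3_eq_cube power2_eq_square algebra_simps)
  moreover have "ereal (\<gamma> + 3 * q) < g N"
  proof -
    have three: "ereal (\<gamma> + 3 * q) < g (3 * d)" if "ereal (\<gamma> + 3 * q) \<le> g d" for d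
      using that val_3 by (cases "g d") (auto simp: in_t_simps in_t_numeral X.mult one_ereal_def)
    have "ereal (\<gamma> + 2 * q + q) \<le> g (C * Q ^ 2 * (?t * pderiv Q))"
      unfolding in_t_simps(5)[of x0 "C * Q ^ 2"]
      using g_t_pderiv[of Q] \<gamma> q X.power_ereal[OF q, of 2]
      by (intro X.mult_ge) (auto simp: in_t_simps(5) in_t_power X.mult)
    then have "ereal (\<gamma> + 3 * q) < g (3 * (C * Q ^ 2 * (?t * pderiv Q)))"
      by (intro three) (simp add: algebra_simps)
    moreover have "g (P ^ 3) \<le> g (P ^ 2 * (?t * pderiv P))"
      using g_t_pderiv[of P] unfolding power3_eq_cube power2_eq_square
      by (simp only: in_t_simps(5)[of _ "P * P"] X.mult add_left_mono)
    then have "ereal (\<gamma> + 3 * q) < g (3 * (P ^ 2 * (?t * pderiv P)))"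
      using P by (intro three) order
    moreover have "ereal (\<gamma> + 3 * q) < g (?t * pderiv E)"
      using E g_t_pderiv[of E] by order
    ultimately show ?thesis
      unfolding N_def in_t_simps(4) by (intro X.diff_gt)
  qed
  moreover have "g (?t * pderiv C * Q ^ 3) = g (?t * pderiv C) + g (Q ^ 3)"
    by (simp only: in_t_simps(5)[of x0 "?t * pderiv C"] X.mult)
  then have "g (?t * pderiv C * Q ^ 3) = ereal (\<gamma> + 3 * q)"
    using g_t_pderiv_eq[of c1 c2 c4] gQ3 \<gamma> unfolding C by simp
  ultimately show False
    by simp
qed

text \<open>The value group of the ground field is divisible and contains the rational numbers, so
  it contains the radius \<open>r\<close> and with it all values of polynomials.\<close>

lemma cube_root_of_value:
  assumes "d \<noteq> 0"
  obtains \<kappa> where "\<kappa> \<noteq> 0" "g d = vK \<kappa> + vK \<kappa> + vK \<kappa>"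
proof -
  obtain m n where mn: "0 < n" "r = of_int m / of_nat n"
    using r_rat by (metis Rats_cases' of_int_of_nat_eq zero_less_imp_eq_int of_nat_0_less_iff)
  obtain \<rho> :: 'k where \<rho>: "\<rho> ^ n = 3 ^ nat \<bar>m\<bar>"
    using nth_root_exists[OF mn(1)] by metis
  have "\<rho> \<noteq> 0"
    using \<rho> mn(1) by (metis power_not_zero zero_neq_numeral zero_power)
  then obtain s where s: "vK \<rho> = ereal s"
    using K.finite_val by blast
  have "real n * s = \<bar>real_of_int m\<bar>"
    using K.power_ereal[OF s, of n] K.power_ereal[of 3 1 "nat \<bar>m\<bar>"] \<rho> vK_3
    by (simp add: one_ereal_def)
  then have "s = \<bar>real_of_int m\<bar> / real n"
    using mn(1) by (simp add: field_simps)
  then have "s = \<bar>r\<bar>"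
    using mn(2) by simp
  define \<tau> where "\<tau> = (if 0 \<le> r then \<rho> else inverse \<rho>)"
  have \<tau>: "\<tau> \<noteq> 0" "vK \<tau> = ereal r"
    unfolding \<tau>_def using \<open>\<rho> \<noteq> 0\<close> s \<open>s = \<bar>r\<bar>\<close> K.inverse_ereal[OF \<open>\<rho> \<noteq> 0\<close> s] by auto
  have "g d \<in> (\<lambda>i. vK (coeff d i) + ereal (real i * r)) ` {..degree d}"
    unfolding gauss by (intro Min_in) auto
  then obtain k where k: "g d = vK (coeff d k) + ereal (real k * r)"
    by blast
  have "coeff d k \<noteq> 0"
    using k assms by (metis K.zero X.eq_inf_iff in_t_eq_0_iff ereal_plus_1(2) plus_ereal.simps(2))
  obtain \<kappa> where \<kappa>: "\<kappa> ^ 3 = coeff d k * \<tau> ^ k"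
    using nth_root_exists[of 3] by (metis zero_less_numeral)
  have "\<kappa> \<noteq> 0"
    using \<kappa> \<open>coeff d k \<noteq> 0\<close> \<tau>(1) by auto
  moreover have "g d = vK \<kappa> + vK \<kappa> + vK \<kappa>"
    using K.power_ereal[OF \<tau>(2), of k] k \<kappa> by (metis K.cube K.mult)
  ultimately show thesis
    by (rule that)
qed

end

section \<open>The different at a wild topological branch point\<close>

theorem corollary4p13:
  fixes vK :: "'k::{alg_closed_field,field_char_0} \<Rightarrow> ereal"
    and A0 B0 C0 :: "'k poly" and x0 y0 v :: 'k
    and emb :: "'k poly fract \<Rightarrow> 'f::field" and y z :: 'f
    and a0' a1' a2' b0' b1' b2' b3' c1' c2' c3' c4' :: 'k
    and a0 a1 a2 b0 b1 b2 b3 c1 c2 c4 :: 'k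
    and A B C :: "'k poly fract"
    and \<xi> :: "'k poly fract \<Rightarrow> ereal" and \<eta> :: "'f \<Rightarrow> ereal"
    and w\<xi> :: "'g::field \<Rightarrow> ereal" and j\<xi> :: "'k poly fract \<Rightarrow> 'g"
    and w\<eta> :: "'h::field \<Rightarrow> ereal" and j\<eta> :: "'f \<Rightarrow> 'h"
    and i :: "'g \<Rightarrow> 'h"
  assumes "ground_field vK"
    and "degree A0 \<le> 2" "degree B0 \<le> 3" "degree C0 \<le> 4"
    and "smooth_plane_quartic A0 B0 C0"
    and "is_function_field A0 B0 C0 emb y"
    \<comment> \<open>\<open>(x0, y0)\<close> is a point of \<open>Y\<close> above \<open>x0\<close>\<close>
    and "y0 ^ 3 + poly A0 x0 * y0 ^ 2 + poly B0 x0 * y0 + poly C0 x0 = 0"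
    and "is_min_poly emb (y - emb (in_x [:y0:]))
           [:in_t x0 [:0, c1', c2', c3', c4':], in_t x0 [:b0', b1', b2', b3':],
             in_t x0 [:a0', a1', a2':], 1:]"
    and "v ^ 3 + a1' * v ^ 2 + b2' * v + c3' = 0"
    and "z = y - emb (in_x [:y0:]) - emb (in_t x0 [:0, v:])"
    and "A = in_t x0 [:a0, a1, a2:]"
    and "B = in_t x0 [:b0, b1, b2, b3:]"
    and "C = in_t x0 [:0, c1, c2, 0, c4:]"
    and "is_min_poly emb z [:C, B, A, 1:]"
    and "type_II_on_path vK x0 \<xi>"
    \<comment> \<open>\<open>\<xi>\<close> is a wild topological branch point, as witnessed by its preimage \<open>\<eta>\<close>\<close>
    and "lies_over emb \<eta> \<xi>"
    and "is_completion \<xi> w\<xi> j\<xi>" and "is_completion \<eta> w\<eta> j\<eta>"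
    and "is_induced emb w\<xi> j\<xi> w\<eta> j\<eta> i"
    and "0 < ext_degree i" and "3 dvd ext_degree i"
  shows "ereal (delta w\<xi> w\<eta> i) = min (3 / 2) (min (3 * \<xi> A / 2 - \<xi> C / 2) (3 * \<xi> B / 2 - \<xi> C))"
proof -
  note ground = assms(1) and min_poly = assms(14) and z_def = assms(10)
    and A_def = assms(11) and B_def = assms(12) and C_def = assms(13)
    and compl_\<xi> = assms(17) and compl_\<eta> = assms(18) and induced = assms(19) and deg = assms(20,21)
  have emb: "field_emb emb" and generated: "\<And>S. is_subfield S \<Longrightarrow> range emb \<subseteq> S \<Longrightarrow> y \<in> S \<Longrightarrow> S = UNIV"
    using assms(6) unfolding is_function_field_def by blast+
  have j\<xi>: "field_emb j\<xi>" "\<And>f. w\<xi> (j\<xi> f) = \<xi> f" "val_dense w\<xi> (range j\<xi>)"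
    using compl_\<xi> unfolding is_completion_def by blast+
  have j\<eta>: "field_emb j\<eta>" "\<And>f. w\<eta> (j\<eta> f) = \<eta> f" "val_dense w\<eta> (range j\<eta>)"
    using compl_\<eta> unfolding is_completion_def by blast+
  have i: "field_emb i" "\<And>a. w\<eta> (i a) = w\<xi> a" "\<And>f. i (j\<xi> f) = j\<eta> (emb f)"
    using induced unfolding is_induced_def by blast+
  note emb_simps = field_emb_simps[OF emb] and j\<xi>_simps = field_emb_simps[OF j\<xi>(1)]
    and j\<eta>_simps = field_emb_simps[OF j\<eta>(1)] and i_simps = field_emb_simps[OF i(1)]
  obtain r where r: "r \<in> \<rat>"
      "\<And>d. \<xi> (in_t x0 d) = (MIN i\<in>{..degree d}. vK (coeff d i) + ereal (real i * r))"
    using assms(15) unfolding type_II_on_path_def by blast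
  interpret gauss_valuation vK \<xi> x0 r
    using ground assms(15) r
    by unfold_locales (auto simp: ground_field_def type_II_on_path_def)
  interpret complete_extension w\<xi> w\<eta> i
    using compl_\<xi> compl_\<eta> i by unfold_locales (auto simp: is_completion_def)

  have root_z: "z ^ 3 + emb A * z ^ 2 + emb B * z + emb C = 0"
    using min_poly unfolding is_min_poly_def
    by (simp add: map_poly_pCons emb_simps power2_eq_square power3_eq_cube algebra_simps)
  have "C \<noteq> 0"
  proof
    assume "C = 0"
    then have "z * (z ^ 2 + emb A * z + emb B) = 0"
      using root_z by (simp add: emb_simps power2_eq_square power3_eq_cube algebra_simps)
    moreover have "z \<noteq> 0"
      using min_poly unfolding is_min_poly_def
      by (auto simp: map_poly_pCons emb_simps dest!: spec[of _ "[:0, 1:]"])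
    moreover have "z ^ 2 + emb A * z + emb B \<noteq> 0"
      using min_poly unfolding is_min_poly_def
      by (auto simp: map_poly_pCons emb_simps power2_eq_square algebra_simps dest!: spec[of _ "[:B, A, 1:]"])
    ultimately show False
      by simp
  qed
  then have Cpoly: "[:0, c1, c2, 0, c4:] \<noteq> 0"
    unfolding C_def by (metis in_t_simps(1))

  obtain \<kappa> where \<kappa>: "\<kappa> \<noteq> 0" "g [:0, c1, c2, 0, c4:] = vK \<kappa> + vK \<kappa> + vK \<kappa>"
    using cube_root_of_value[OF Cpoly] .
  define k where "k = j\<xi> (in_t x0 [:\<kappa>:])"
  have k0: "k \<noteq> 0"
    unfolding k_def using \<kappa>(1) by (simp add: j\<xi>_simps in_t_eq_0_iff)
  obtain \<gamma> where \<gamma>: "vK \<kappa> = ereal \<gamma>"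
    using K.finite_val[OF \<kappa>(1)] .
  have val_k: "w\<xi> k = ereal \<gamma>"
    unfolding k_def using \<gamma> by (simp add: j\<xi>(2) g_const)
  have val_C: "\<xi> C = ereal (3 * \<gamma>)"
    unfolding C_def using \<kappa>(2) \<gamma> by simp

  \<comment> \<open>The rescaled generator and its cubic, with unit constant coefficient.\<close>
  define \<zeta> where "\<zeta> = j\<eta> z / i k"
  define a where "a = j\<xi> A / k"
  define b where "b = j\<xi> B / k ^ 2"
  define c where "c = j\<xi> C / k ^ 3"
  have root: "\<zeta> ^ 3 + i a * \<zeta> ^ 2 + i b * \<zeta> + i c = 0"
  proof -
    have "j\<eta> (z ^ 3 + emb A * z ^ 2 + emb B * z + emb C) = 0"
      unfolding root_z by (simp add: j\<eta>_simps)
    then have "(j\<eta> z ^ 3 + i (j\<xi> A) * j\<eta> z ^ 2 + i (j\<xi> B) * j\<eta> z + i (j\<xi> C)) / i k ^ 3 = 0"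
      by (simp add: j\<eta>_simps i(3))
    then show ?thesis
      unfolding \<zeta>_def a_def b_def c_def i_simps using k0
      by (simp add: i_simps power_divide add_divide_distrib power2_eq_square power3_eq_cube mult.assoc)
  qed
  interpret cubic_root i \<zeta> a b c
    by unfold_locales (fact i(1) root)+
  have Span_closed: "val_closed w\<eta> Span"
    unfolding Span_def by (rule span_1_z_z2_closed)
  \<comment> \<open>The elements with image in the span form a subfield that contains \<open>K(x)\<close> and \<open>y\<close>.\<close>
  have j\<eta>_Span: "j\<eta> f \<in> Span" for f
  proof -
    define S where "S = {f. j\<eta> f \<in> Span}"
    have base: "j\<eta> (emb f) \<in> Span" for f
      using Span_base[of "j\<xi> f"] i(3) by simp
    have "is_subfield S"
      unfolding is_subfield_def S_def
      using base[of 0] base[of 1] by (auto simp: emb_simps j\<eta>_simps intro: Span_diff Span_mult Span_inverse)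
    moreover have "range emb \<subseteq> S"
      unfolding S_def using base by blast
    moreover have "y \<in> S"
    proof -
      have "j\<eta> y = i k * \<zeta> - j\<eta> (emb (- in_x [:y0:] - in_t x0 [:0, v:]))"
        unfolding \<zeta>_def z_def using k0 by (simp add: i_simps j\<eta>_simps emb_simps)
      then show ?thesis
        unfolding S_def using Span_diff Span_mult Span_base Span_z base by simp
    qed
    ultimately show ?thesis
      using generated unfolding S_def by blast
  qed
  then have Span_UNIV: "Span = UNIV"
    using H.closed_dense[OF Span_closed j\<eta>(3)] by blast

  have val_a: "w\<xi> a + ereal \<gamma> = \<xi> A" and val_b: "w\<xi> b + ereal (2 * \<gamma>) = \<xi> B"
  proof -
    have "a * k = j\<xi> A" "b * k ^ 2 = j\<xi> B"
      unfolding a_def b_def using k0 by simp_all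
    then show "w\<xi> a + ereal \<gamma> = \<xi> A" "w\<xi> b + ereal (2 * \<gamma>) = \<xi> B"
      using val_k G.power_ereal[OF val_k, of 2] j\<xi>(2) by (metis G.mult of_nat_numeral)+
  qed
  have val_c: "w\<xi> c = 0"
  proof -
    have "w\<xi> c = ereal (3 * \<gamma> - real 3 * \<gamma>)"
      unfolding c_def using k0 val_C by (intro G.divide_ereal G.power_ereal val_k) (auto simp: j\<xi>(2))
    then show ?thesis
      by simp
  qed
  have no_root: "s ^ 3 + a * s ^ 2 + b * s + c \<noteq> 0" for s
    using no_root_in_base[OF deg Span_UNIV] .
  have three: "w\<xi> 3 = 1"
    using j\<xi>(2)[of 3] val_3 by (simp add: j\<xi>_simps)
  have ab: "0 \<le> w\<xi> a" "0 \<le> w\<xi> b"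
    using G.rootless_cubic_integral[OF val_c no_root] by blast+
  have no_residue_root: "\<not> 0 < w\<xi> (s ^ 3 + a * s ^ 2 + b * s + c)" if s: "0 \<le> w\<xi> s" for s
  proof
    assume "0 < w\<xi> (s ^ 3 + a * s ^ 2 + b * s + c)"
    then have cube: "0 < w\<xi> (c + s ^ 3)"
      using three by (intro G.rootless_cubic_residue_root[OF _ ab no_root s]) auto
    \<comment> \<open>Approximating \<open>s\<close> by a rational function brings the congruence down to \<open>K(t)\<close>.\<close>
    obtain f where f: "ereal 1 \<le> w\<xi> (s - j\<xi> f)"
      using j\<xi>(3) unfolding val_dense_def by blast
    have "0 < w\<xi> (s - j\<xi> f)"
      using f by (rule less_le_trans[rotated]) simp
    moreover have "0 \<le> w\<xi> (j\<xi> f)"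
      using G.diff_ge[OF s less_imp_le[OF calculation]] by simp
    ultimately have "0 < w\<xi> ((c + s ^ 3) - (s - j\<xi> f) * (s ^ 2 + s * j\<xi> f + j\<xi> f ^ 2))"
      using cube s by (intro G.diff_gt[of _ "c + s ^ 3"] G.mult_pos G.ring_nonneg) auto
    also have "(c + s ^ 3) - (s - j\<xi> f) * (s ^ 2 + s * j\<xi> f + j\<xi> f ^ 2) = c + j\<xi> f ^ 3"
      by algebra
    finally have pos: "0 < w\<xi> (c + j\<xi> f ^ 3)" .
    have "j\<xi> (C + (f * in_t x0 [:\<kappa>:]) ^ 3) = k ^ 3 * (c + j\<xi> f ^ 3)"
      unfolding c_def using k0 by (simp add: j\<xi>_simps k_def[symmetric] power_mult_distrib field_simps)
    then have "\<xi> (C + (f * in_t x0 [:\<kappa>:]) ^ 3) = ereal (3 * \<gamma>) + w\<xi> (c + j\<xi> f ^ 3)"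
      using j\<xi>(2) G.power_ereal[OF val_k, of 3] by (metis G.mult of_nat_numeral)
    moreover have "\<xi> (C + (f * in_t x0 [:\<kappa>:]) ^ 3) \<le> \<xi> C"
      unfolding C_def by (intro not_near_cube[OF refl Cpoly])
    ultimately show False
      using pos val_C by (cases "w\<xi> (c + j\<xi> f ^ 3)") auto
  qed
  interpret residually_irreducible_cubic w\<xi> w\<eta> i \<zeta> a b c
    using ab val_c no_residue_root Span_UNIV i by unfold_locales simp_all
  have "ereal (delta w\<xi> w\<eta> i) = 3 / 2 * min 1 (min (w\<xi> a) (w\<xi> b))"
    by (rule delta_eq[OF three])
  also have "\<dots> = min (3 / 2) (min (3 * \<xi> A / 2 - \<xi> C / 2) (3 * \<xi> B / 2 - \<xi> C))"
    unfolding val_a[symmetric] val_b[symmetric] val_C using ab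
    by (cases "w\<xi> a"; cases "w\<xi> b") (auto simp: min_def one_ereal_def numeral_eq_ereal field_simps)
  finally show ?thesis .
qed

end
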